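(* Let $\mu>-1/2$. 1. For all $g\in\mathcal{B}^2_{e,\mu}$, the $\mu$-deformed energy $E_{e,\mu}(g)$ is finite if and only if the Dirichlet energy $\|D_\mu g\|^2_{\mathcal{B}^2_\mu}$ is finite. 2. For all $h\in\mathcal{B}^2_{o,\mu}$, the $\mu$-deformed energy $E_{o,\mu}(h)$ is finite if and only if the Dirichlet energy $\|D_\mu h\|^2_{\mathcal{B}^2_\mu}$ is finite. 3. For all $f\in\mathcal{B}^2_\mu$, the $\mu$-deformed energy $E_\mu(f)$ is finite if and only if the Dirichlet energy $\|D_\mu f\|^2_{\mathcal{B}^2_\mu}$ is finite.
   Context: Fix $\mu>-1/2$. For $x>0$ and $\alpha\in\mathbf{R}$, $K_\alpha(x)=\int_0^\infty e^{-x\cosh u}\cosh(\alpha u)\,du$ is the Macdonald function. On $\mathbf{C}$ define the finite measures $d\nu_{e,\mu}(z)=\nu_{e,\mu}(z)\,dx\,dy$ and $d\nu_{o,\mu}(z)=\nu_{o,\mu}(z)\,dx\,dy$ with densities, for $z\neq0$, $$\nu_{e,\mu}(z)=\frac{2^{\frac12-\mu}}{\pi\Gamma(\mu+\frac12)}K_{\mu-\frac12}(|z|^2)|z|^{2\mu+1},\qquad \nu_{o,\mu}(z)=\frac{2^{\frac12-\mu}}{\pi\Gamma(\mu+\frac12)}K_{\mu+\frac12}(|z|^2)|z|^{2\mu+1}.$$ For $f:\mathbf{C}\to\mathbf{C}$, $f_e(z)=(f(z)+f(-z))/2$ and $f_o(z)=(f(z)-f(-z))/2$ are its even and odd parts.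 $\mathcal{B}^2_\mu$ is the space of entire functions $f$ with $f_e\in L^2(\mathbf{C},\nu_{e,\mu})$ and $f_o\in L^2(\mathbf{C},\nu_{o,\mu})$, with norm $\|f\|^2_{\mathcal{B}^2_\mu}=\|f_e\|^2_{L^2(\nu_{e,\mu})}+\|f_o\|^2_{L^2(\nu_{o,\mu})}$; $\mathcal{B}^2_{e,\mu}$ and $\mathcal{B}^2_{o,\mu}$ are its subspaces of even and odd functions. $\mu$-deformed energies (values in $[0,+\infty]$): $E_{e,\mu}(g)=\int_{\mathbf{C}}|z|^2|g(z)|^2\,d\nu_{e,\mu}(z)$ for $g\in\mathcal{B}^2_{e,\mu}$, $E_{o,\mu}(h)=\int_{\mathbf{C}}|z|^2|h(z)|^2\,d\nu_{o,\mu}(z)$ for $h\in\mathcal{B}^2_{o,\mu}$, and $E_\mu(f)=E_{e,\mu}(f_e)+E_{o,\mu}(f_o)$ for $f\in\mathcal{B}^2_\mu$. For an entire function $f$, $D_\mu f$ is the entire function $D_\mu f(z)=f'(z)+\frac{\mu}{z}(f(z)-f(-z))$ (removable singularity at $0$). The Dirichlet energy of $f\in\mathcal{B}^2_\mu$ is $\|D_\mu f\|^2_{\mathcal{B}^2_\mu}$ if $D_\mu f\in\mathcal{B}^2_\mu$ and $+\infty$ otherwise. *)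

theory Defs
  imports "HOL-Complex_Analysis.Complex_Analysis"
begin

definition macdonald_K :: "real \<Rightarrow> real \<Rightarrow> real" where
  "macdonald_K \<alpha> x = (LBINT u:{0..}. exp (- (x * cosh u)) * cosh (\<alpha> * u))"

text \<open>The values of the two densities at \<open>z = 0\<close>, where the integral defining the
  Macdonald function diverges, are irrelevant: they are only used as densities with respect to
  planar Lebesgue measure.\<close>

definition dens_e :: "real \<Rightarrow> complex \<Rightarrow> real" where
  "dens_e \<mu> z = 2 powr (1/2 - \<mu>) / (pi * Gamma (\<mu> + 1/2))
     * macdonald_K (\<mu> - 1/2) ((cmod z)\<^sup>2) * cmod z powr (2 * \<mu> + 1)"

definition dens_o :: "real \<Rightarrow> complex \<Rightarrow> real" where
  "dens_o \<mu> z = 2 powr (1/2 - \<mu>) / (pi * Gamma (\<mu> + 1/2))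
     * macdonald_K (\<mu> + 1/2) ((cmod z)\<^sup>2) * cmod z powr (2 * \<mu> + 1)"

definition nu_e :: "real \<Rightarrow> complex measure" where
  "nu_e \<mu> = density lborel (\<lambda>z. ennreal (dens_e \<mu> z))"

definition nu_o :: "real \<Rightarrow> complex measure" where
  "nu_o \<mu> = density lborel (\<lambda>z. ennreal (dens_o \<mu> z))"

definition even_part :: "(complex \<Rightarrow> complex) \<Rightarrow> complex \<Rightarrow> complex" where
  "even_part f z = (f z + f (- z)) / 2"

definition odd_part :: "(complex \<Rightarrow> complex) \<Rightarrow> complex \<Rightarrow> complex" where
  "odd_part f z = (f z - f (- z)) / 2"

definition L2_norm_sq :: "'a measure \<Rightarrow> ('a \<Rightarrow> complex) \<Rightarrow> ennreal" where
  "L2_norm_sq M f = (\<integral>\<^sup>+ z. ennreal ((cmod (f z))\<^sup>2) \<partial>M)"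

definition L2_space :: "'a measure \<Rightarrow> ('a \<Rightarrow> complex) set" where
  "L2_space M = {f \<in> borel_measurable M. L2_norm_sq M f < \<infinity>}"

definition B2 :: "real \<Rightarrow> (complex \<Rightarrow> complex) set" where
  "B2 \<mu> = {f. f holomorphic_on UNIV \<and>
              even_part f \<in> L2_space (nu_e \<mu>) \<and> odd_part f \<in> L2_space (nu_o \<mu>)}"

definition B2_norm_sq :: "real \<Rightarrow> (complex \<Rightarrow> complex) \<Rightarrow> ennreal" where
  "B2_norm_sq \<mu> f = L2_norm_sq (nu_e \<mu>) (even_part f) + L2_norm_sq (nu_o \<mu>) (odd_part f)"

definition B2_even :: "real \<Rightarrow> (complex \<Rightarrow> complex) set" where
  "B2_even \<mu> = {f \<in> B2 \<mu>. \<forall>z. f (- z) = f z}"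

definition B2_odd :: "real \<Rightarrow> (complex \<Rightarrow> complex) set" where
  "B2_odd \<mu> = {f \<in> B2 \<mu>. \<forall>z. f (- z) = - f z}"

definition energy_e :: "real \<Rightarrow> (complex \<Rightarrow> complex) \<Rightarrow> ennreal" where
  "energy_e \<mu> g = (\<integral>\<^sup>+ z. ennreal ((cmod z)\<^sup>2 * (cmod (g z))\<^sup>2) \<partial>nu_e \<mu>)"

definition energy_o :: "real \<Rightarrow> (complex \<Rightarrow> complex) \<Rightarrow> ennreal" where
  "energy_o \<mu> h = (\<integral>\<^sup>+ z. ennreal ((cmod z)\<^sup>2 * (cmod (h z))\<^sup>2) \<partial>nu_o \<mu>)"

definition energy :: "real \<Rightarrow> (complex \<Rightarrow> complex) \<Rightarrow> ennreal" where
  "energy \<mu> f = energy_e \<mu> (even_part f) + energy_o \<mu> (odd_part f)"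

text \<open>For entire \<open>f\<close>, \<open>remove_sings\<close> only changes the value at the removable singularity \<open>0\<close>;
  see \<open>dunkl_D_nonzero\<close>, \<open>dunkl_D_zero\<close> and \<open>dunkl_D_entire\<close> below.\<close>

definition dunkl_D :: "real \<Rightarrow> (complex \<Rightarrow> complex) \<Rightarrow> complex \<Rightarrow> complex" where
  "dunkl_D \<mu> f = remove_sings (\<lambda>z. deriv f z + of_real \<mu> / z * (f z - f (- z)))"

definition dirichlet_energy :: "real \<Rightarrow> (complex \<Rightarrow> complex) \<Rightarrow> ennreal" where
  "dirichlet_energy \<mu> f = (if dunkl_D \<mu> f \<in> B2 \<mu> then B2_norm_sq \<mu> (dunkl_D \<mu> f) else \<infinity>)"

lemma dunkl_D_nonzero:
  assumes "f holomorphic_on UNIV" "z \<noteq> 0"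
  shows "dunkl_D \<mu> f z = deriv f z + of_real \<mu> / z * (f z - f (- z))"
proof -
  have "(\<lambda>z. deriv f z + of_real \<mu> / z * (f z - f (- z))) holomorphic_on (- {0})"
    by (intro holomorphic_intros holomorphic_on_compose_gen[of uminus _ f UNIV, unfolded o_def]
        holomorphic_deriv[of f UNIV, THEN holomorphic_on_subset]
        holomorphic_on_subset[OF assms(1)] assms(1)) auto
  then have "(\<lambda>z. deriv f z + of_real \<mu> / z * (f z - f (- z))) analytic_on {z}"
    using assms(2) by (intro analytic_at[THEN iffD2] exI[of _ "- {0}"]) auto
  then show ?thesis
    unfolding dunkl_D_def by (rule remove_sings_at_analytic)
qed

lemma dunkl_D_zero:
  assumes "f holomorphic_on UNIV"
  shows "dunkl_D \<mu> f 0 = (1 + 2 * of_real \<mu>) * deriv f 0"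
proof -
  have d: "(f has_field_derivative deriv f 0) (at 0)"
    using assms by (simp add: holomorphic_derivI)
  have d': "((\<lambda>z. f (- z)) has_field_derivative - deriv f 0) (at 0)"
    using DERIV_chain2[OF _ DERIV_minus[OF DERIV_ident], of f "deriv f 0" 0] d by simp
  have "((\<lambda>z. f z - f (- z)) has_field_derivative 2 * deriv f 0) (at 0)"
    using DERIV_diff[OF d d'] by simp
  then have q: "((\<lambda>z. (f z - f (- z)) / z) \<longlongrightarrow> 2 * deriv f 0) (at 0)"
    by (simp add: has_field_derivative_iff)
  have "isCont (deriv f) 0"
    using holomorphic_deriv[OF assms open_UNIV] holomorphic_on_imp_continuous_on
      continuous_on_eq_continuous_at open_UNIV by blast
  then have c: "(deriv f \<longlongrightarrow> deriv f 0) (at 0)"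
    by (simp add: isCont_def)
  have "((\<lambda>z. deriv f z + of_real \<mu> * ((f z - f (- z)) / z))
      \<longlongrightarrow> deriv f 0 + of_real \<mu> * (2 * deriv f 0)) (at 0)"
    by (intro tendsto_intros q c)
  then have "((\<lambda>z. deriv f z + of_real \<mu> / z * (f z - f (- z)))
      \<longlongrightarrow> (1 + 2 * of_real \<mu>) * deriv f 0) (at 0)"
    by (simp add: algebra_simps diff_divide_distrib)
  then show ?thesis
    unfolding dunkl_D_def by (rule remove_sings_eqI)
qed

lemma dunkl_D_entire:
  assumes "f holomorphic_on UNIV"
  shows "dunkl_D \<mu> f holomorphic_on UNIV"
proof -
  let ?q = "\<lambda>z. if z = 0 then deriv (\<lambda>z. f z - f (- z)) 0
                else ((f z - f (- z)) - (f 0 - f (- 0))) / (z - 0)"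
  have hm: "(\<lambda>z. f (- z)) holomorphic_on UNIV"
    by (intro holomorphic_on_compose_gen[of uminus UNIV f UNIV, unfolded o_def]
        holomorphic_intros assms) auto
  have q: "?q holomorphic_on UNIV"
    by (rule pole_lemma) (auto intro!: holomorphic_intros assms hm)
  have d: "(f has_field_derivative deriv f 0) (at 0)"
    using assms by (simp add: holomorphic_derivI)
  have d': "((\<lambda>z. f (- z)) has_field_derivative - deriv f 0) (at 0)"
    using DERIV_chain2[OF _ DERIV_minus[OF DERIV_ident], of f "deriv f 0" 0] d by simp
  have d0: "deriv (\<lambda>z. f z - f (- z)) 0 = 2 * deriv f 0"
    using DERIV_imp_deriv[OF DERIV_diff[OF d d']] by simp
  have "dunkl_D \<mu> f = (\<lambda>z. deriv f z + of_real \<mu> * ?q z)"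
  proof
    fix z
    show "dunkl_D \<mu> f z = deriv f z + of_real \<mu> * ?q z"
      by (cases "z = 0")
        (simp_all add: d0 dunkl_D_zero[OF assms] dunkl_D_nonzero[OF assms] algebra_simps diff_divide_distrib)
  qed
  moreover have "(\<lambda>z. deriv f z + of_real \<mu> * ?q z) holomorphic_on UNIV"
    by (intro holomorphic_on_add holomorphic_on_mult holomorphic_on_const q
        holomorphic_deriv[OF assms open_UNIV])
  ultimately show ?thesis by simp
qed

end

theory Submission
  imports Defs "HOL-Real_Asymp.Real_Asymp"
begin

text \<open>
  All weights are radial, so for \<open>f z = (\<Sum>n. a\<^sub>n z\<^sup>n)\<close> every quantity in the statement is a series
  \<open>(\<Sum>n. \<bar>a\<^sub>n\<bar>\<^sup>2 c\<^sub>n)\<close>, where \<open>c\<^sub>n\<close> is built from the moments \<open>M\<^sub>e n\<close> and \<open>M\<^sub>o n\<close> of \<open>\<bar>z\<bar>\<close> to the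
  power \<open>2 n\<close> under the two measures.  An integration by parts in the integral representation of the
  Macdonald function gives \<open>M\<^sub>e (n + 1) = (n + 1) M\<^sub>o n\<close> and \<open>M\<^sub>o (n + 1) = (n + 2 \<mu> + 1) M\<^sub>e n\<close>.
  Hence the Dirichlet energy has coefficients \<open>n M\<^sub>e n\<close> (even \<open>n\<close>) and \<open>(n + 2 \<mu>) M\<^sub>o n\<close> (odd \<open>n\<close>),
  whereas the deformed energy has \<open>M\<^sub>e (n + 1)\<close> and \<open>M\<^sub>o (n + 1)\<close>.  The arithmetic-geometric mean
  inequality \<open>2 M n \<le> l M (n - 1) + M (n + 1) / l\<close> with \<open>l\<close> of order \<open>n\<close>, together with these
  recurrences, shows that the two are comparable up to multiples of the norm.
\<close>

subsection \<open>Planar Lebesgue measure\<close>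

lemma nn_integral_lborel_translate:
  fixes f :: "'a::euclidean_space \<Rightarrow> ennreal"
  assumes [measurable]: "f \<in> borel_measurable borel"
  shows "(\<integral>\<^sup>+x. f (a + x) \<partial>lborel) = (\<integral>\<^sup>+x. f x \<partial>lborel)"
  by (subst (2) lborel_distr_plus[of a, symmetric]) (simp add: nn_integral_distr)

text \<open>The usual argument for the uniqueness of translation invariant measures: both sides are compared
  through a convolution with the indicator of the unit disc, which is itself invariant under rotations.\<close>

lemma nn_integral_lborel_rotate:
  fixes f :: "complex \<Rightarrow> ennreal"
  assumes [measurable]: "f \<in> borel_measurable borel" and c: "cmod c = 1"
  shows "(\<integral>\<^sup>+x. f (c * x) \<partial>lborel) = (\<integral>\<^sup>+x. f x \<partial>lborel)"
proof -
  let ?g = "indicator (ball 0 1) :: complex \<Rightarrow> ennreal"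
  let ?b = "emeasure lborel (ball 0 1 :: complex set)"
  have [simp]: "c \<noteq> 0" using c by auto
  have g[measurable]: "?g \<in> borel_measurable borel" by (simp add: borel_measurable_indicator)
  have "(\<integral>\<^sup>+x. f (c * x) \<partial>lborel) * ?b = (\<integral>\<^sup>+x. f (c * x) * (\<integral>\<^sup>+y. ?g y \<partial>lborel) \<partial>lborel)"
    by (simp add: nn_integral_multc)
  also have "\<dots> = (\<integral>\<^sup>+x. \<integral>\<^sup>+y. f (c * x) * ?g y \<partial>lborel \<partial>lborel)"
    by (subst nn_integral_cmult) (simp_all add: borel_measurable_indicator)
  also have "\<dots> = (\<integral>\<^sup>+y. \<integral>\<^sup>+x. f (c * x) * ?g y \<partial>lborel \<partial>lborel)"
    by (rule lborel_pair.Fubini') (use measurable_compose[OF _ g] in measurable)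
  also have "\<dots> = (\<integral>\<^sup>+y. \<integral>\<^sup>+x. f (c * x + y) * ?g y \<partial>lborel \<partial>lborel)"
  proof (rule nn_integral_cong)
    fix y :: complex
    \<comment> \<open>Translating \<open>x\<close> by \<open>y / c\<close> turns
      \<open>c * x\<close> into \<open>c * x + y\<close>.\<close>
    show "(\<integral>\<^sup>+x. f (c * x) * ?g y \<partial>lborel) = (\<integral>\<^sup>+x. f (c * x + y) * ?g y \<partial>lborel)"
      by (subst nn_integral_lborel_translate[of "\<lambda>x. f (c * x) * ?g y" "y / c", symmetric])
        (simp_all add: algebra_simps)
  qed
  also have "\<dots> = (\<integral>\<^sup>+x. \<integral>\<^sup>+y. f (c * x + y) * ?g y \<partial>lborel \<partial>lborel)"
    by (rule lborel_pair.Fubini') (use measurable_compose[OF _ g] in measurable)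
  also have "\<dots> = (\<integral>\<^sup>+x. \<integral>\<^sup>+y. f y * ?g (y - c * x) \<partial>lborel \<partial>lborel)"
  proof (rule nn_integral_cong)
    fix x :: complex
    show "(\<integral>\<^sup>+y. f (c * x + y) * ?g y \<partial>lborel) = (\<integral>\<^sup>+y. f y * ?g (y - c * x) \<partial>lborel)"
      by (subst nn_integral_lborel_translate[of "\<lambda>y. f y * ?g (y - c * x)" "c * x", symmetric])
        simp_all
  qed
  also have "\<dots> = (\<integral>\<^sup>+y. \<integral>\<^sup>+x. f y * ?g (y - c * x) \<partial>lborel \<partial>lborel)"
    by (rule lborel_pair.Fubini') (use measurable_compose[OF _ g] in measurable)
  also have "\<dots> = (\<integral>\<^sup>+y. f y * ?b \<partial>lborel)"
  proof (rule nn_integral_cong)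
    fix y :: complex
    \<comment> \<open>Here \<open>cmod c = 1\<close> enters: as a function of \<open>x\<close> this
      is again the indicator of a unit disc, now centred at \<open>y / c\<close>, so its area does
      not depend on \<open>y\<close>.\<close>
    have "?g (y - c * x) = indicator (ball (y / c) 1) x" for x
    proof -
      have "y - c * x = c * (y / c - x)" by (simp add: algebra_simps)
      then have "cmod (y - c * x) = cmod (y / c - x)" using c by (metis mult_1 norm_mult)
      then show ?thesis by (simp add: indicator_def dist_norm norm_minus_commute)
    qed
    then show "(\<integral>\<^sup>+x. f y * ?g (y - c * x) \<partial>lborel) = f y * ?b"
      by (simp add: nn_integral_cmult_indicator emeasure_ball)
  qed
  also have "\<dots> = (\<integral>\<^sup>+y. f y \<partial>lborel) * ?b"
    by (simp add: nn_integral_multc)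
  finally have "(\<integral>\<^sup>+x. f (c * x) \<partial>lborel) * ?b = (\<integral>\<^sup>+y. f y \<partial>lborel) * ?b" .
  \<comment> \<open>The common factor can be cancelled because it is neither 0 nor infinite.\<close>
  moreover have "?b = ennreal pi"
    by (simp add: emeasure_ball unit_ball_vol_2)
  ultimately show ?thesis
    using ennreal_mult_cancel_left[of "ennreal pi"] by (simp add: mult.commute)
qed

text \<open>A disc of squared radius \<open>x\<close> has area \<open>pi * x\<close>, so the squared
  modulus pushes planar measure forward to \<open>pi\<close> times Lebesgue measure on the
  half-line; the rays \<open>{..<x}\<close> suffice to compare the two measures. Using the square
  makes the density constant and matches the argument of the Macdonald function in the
  weights.\<close>

lemma nn_integral_complex_radial:
  fixes f :: "real \<Rightarrow> ennreal"
  assumes [measurable]: "f \<in> borel_measurable borel"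
  shows "(\<integral>\<^sup>+z. f ((cmod z)\<^sup>2) \<partial>lborel) = ennreal pi * (\<integral>\<^sup>+t\<in>{0..}. f t \<partial>lborel)"
proof -
  let ?M = "distr lborel borel (\<lambda>z::complex. (cmod z)\<^sup>2)"
  let ?N = "density lborel (\<lambda>t. ennreal pi * indicator {0..} t) :: real measure"
  have ball: "{z. (cmod z)\<^sup>2 < x} = ball 0 (sqrt x)" if "x \<ge> 0" for x
  proof -
    have "(cmod z)\<^sup>2 < x \<longleftrightarrow> cmod z < sqrt x" for z
      using real_sqrt_less_iff[of "(cmod z)\<^sup>2" x] by (simp del: real_sqrt_less_iff)
    then show ?thesis by (simp add: set_eq_iff)
  qed
  have "?M = ?N"
  proof (rule measure_eqI_generator_eq[where E = "range lessThan" and \<Omega> = UNIV and A = "\<lambda>n. {..<real n}"])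
    show "Int_stable (range (lessThan :: real \<Rightarrow> _))"
      by (auto simp: Int_stable_def intro: image_eqI[of _ _ "min a b" for a b])
    show "sets ?M = sigma_sets UNIV (range lessThan)" "sets ?N = sigma_sets UNIV (range lessThan)"
      by (simp_all add: borel_Iio)
    show "(\<Union>i. {..<real i}) = UNIV" by (auto simp: reals_Archimedean2)
    have *: "emeasure ?M {..<x} = ennreal (pi * max 0 x)" for x
    proof -
      have "emeasure ?M {..<x} = emeasure lborel {z. (cmod z)\<^sup>2 < x}"
        by (simp add: emeasure_distr vimage_def)
      also have "\<dots> = ennreal (pi * max 0 x)"
      proof (cases "x \<ge> 0")
        case True
        then show ?thesis by (simp add: ball emeasure_ball unit_ball_vol_2)
      next
        case False
        then have "\<not> (cmod z)\<^sup>2 < x" for z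
          using zero_le_power2[of "cmod z"] by linarith
        then show ?thesis using False by (simp add: max_def)
      qed
      finally show ?thesis .
    qed
    show "emeasure ?M {..<real i} \<noteq> \<infinity>" for i unfolding * by simp
    fix X :: "real set" assume "X \<in> range lessThan"
    then obtain x where X: "X = {..<x}" by auto
    have "emeasure ?N X = (\<integral>\<^sup>+t. ennreal pi * indicator {0..} t * indicator X t \<partial>lborel)"
      by (rule emeasure_density) (simp_all add: X)
    also have "\<dots> = (\<integral>\<^sup>+t. ennreal pi * indicator {0..<x} t \<partial>lborel)"
      by (rule nn_integral_cong) (auto simp: X indicator_def)
    also have "\<dots> = ennreal pi * emeasure lborel {0..<x}"
      by (simp add: nn_integral_cmult_indicator)
    also have "ennreal pi * emeasure lborel {0..<x} = ennreal (pi * max 0 x)"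
      by (cases "x \<ge> 0") (simp_all add: ennreal_mult max_def)
    finally show "emeasure ?M X = emeasure ?N X" by (simp add: * X)
  qed auto
  then have "(\<integral>\<^sup>+t. f t \<partial>?M) = (\<integral>\<^sup>+t. f t \<partial>?N)" by simp
  then show ?thesis
    by (simp add: nn_integral_distr nn_integral_density nn_integral_cmult mult_ac)
qed

subsection \<open>Parseval for radial weights\<close>

text \<open>Orthogonality of characters: off the diagonal the integrand is
  \<open>cis (k * t)\<close> with a nonzero integer \<open>k\<close>, and its primitive takes equal
  values at both endpoints.\<close>

lemma has_integral_cis_power:
  "((\<lambda>t. cis t ^ m * cnj (cis t ^ n)) has_integral (if m = n then 2 * pi else 0)) {0..2 * pi}"
proof (cases "m = n")
  case True
  have "cis t ^ n * cnj (cis t ^ n) = 1" for t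
    using complex_norm_square[of "cis t ^ n"] by (simp add: norm_power)
  then show ?thesis
    using True has_integral_const_real[of "1::complex" 0 "2 * pi"] by (simp add: scaleR_conv_of_real)
next
  case False
  define k :: real where "k = of_int (int m - int n)"
  have k: "k \<noteq> 0" "k \<in> \<int>" using False by (simp_all add: k_def)
  have eq: "cis t ^ m * cnj (cis t ^ n) = cis (k * t)" for t
    by (simp add: Complex.DeMoivre cis_cnj cis_mult k_def algebra_simps)
  have "((\<lambda>t. cis (k * t)) has_integral (cis (k * (2 * pi)) / (\<i> * k) - cis (k * 0) / (\<i> * k))) {0..2 * pi}"
  proof (rule fundamental_theorem_of_calculus)
    show "((\<lambda>t. cis (k * t) / (\<i> * k)) has_vector_derivative cis (k * t)) (at t within {0..2 * pi})" for t
      using k(1) unfolding has_vector_derivative_def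
      by (auto intro!: derivative_eq_intros simp: fun_eq_iff scaleR_conv_of_real mult.left_commute[of "of_real _" \<i>])
  qed simp
  also have "cis (k * (2 * pi)) = 1"
    using cis_multiple_2pi[OF k(2)] by (simp add: mult_ac)
  finally show ?thesis using False unfolding eq by simp
qed

lemma has_integral_norm_trig_polynomial:
  fixes a :: "nat \<Rightarrow> complex"
  shows "((\<lambda>t. (cmod (\<Sum>n<N. a n * cis t ^ n))\<^sup>2) has_integral 2 * pi * (\<Sum>n<N. (cmod (a n))\<^sup>2)) {0..2 * pi}"
proof -
  have "((\<lambda>t. \<Sum>m<N. \<Sum>n<N. a m * cnj (a n) * (cis t ^ m * cnj (cis t ^ n))) has_integral
      (\<Sum>m<N. \<Sum>n<N. a m * cnj (a n) * (if m = n then 2 * pi else 0))) {0..2 * pi}"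
    by (intro has_integral_sum has_integral_mult_right has_integral_cis_power) auto
  also have "(\<lambda>t. \<Sum>m<N. \<Sum>n<N. a m * cnj (a n) * (cis t ^ m * cnj (cis t ^ n)))
      = (\<lambda>t. complex_of_real ((cmod (\<Sum>n<N. a n * cis t ^ n))\<^sup>2))"
    by (simp only: complex_norm_square sum_product cnj_sum complex_cnj_mult mult_ac)
  also have "(\<Sum>m<N. \<Sum>n<N. a m * cnj (a n) * (if m = n then 2 * pi else 0))
      = (\<Sum>m<N. a m * cnj (a m) * (2 * pi))"
    by (intro sum.cong refl) (simp add: if_distrib[of "\<lambda>x. _ * complex_of_real x"] cong: if_cong)
  also have "\<dots> = complex_of_real (2 * pi * (\<Sum>n<N. (cmod (a n))\<^sup>2))"
    by (simp add: complex_norm_square sum_distrib_left mult_ac del: of_real_power)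
  finally show ?thesis
    by (drule_tac has_integral_linear[OF _ bounded_linear_Re]) (simp add: o_def)
qed

text \<open>Parseval passes from partial sums to the series by dominated convergence; the constant
  \<open>(\<Sum>n. cmod (a n))\<^sup>2\<close> dominates on the circle.\<close>

lemma nn_integral_circle_power_series:
  fixes a :: "nat \<Rightarrow> complex"
  assumes a: "summable (\<lambda>n. cmod (a n))"
  shows "(\<integral>\<^sup>+t\<in>{0..2 * pi}. ennreal ((cmod (\<Sum>n. a n * cis t ^ n))\<^sup>2) \<partial>lborel)
    = ennreal (2 * pi) * (\<Sum>n. ennreal ((cmod (a n))\<^sup>2))"
proof -
  let ?S = "\<lambda>N t. \<Sum>n<N. a n * cis t ^ n"
  let ?g = "\<lambda>t. (cmod (\<Sum>n. a n * cis t ^ n))\<^sup>2"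
  have sm: "summable (\<lambda>n. a n * cis t ^ n)" for t
    by (rule summable_norm_cancel) (simp add: norm_mult norm_power a)
  have lim: "(\<lambda>N. (cmod (?S N t))\<^sup>2) \<longlonglongrightarrow> ?g t" for t
    by (intro tendsto_intros summable_LIMSEQ sm)
  have bound: "(cmod (?S N t))\<^sup>2 \<le> (\<Sum>n. cmod (a n))\<^sup>2" for N t
  proof (rule power_mono)
    have "cmod (?S N t) \<le> (\<Sum>n<N. cmod (a n))"
      by (rule order_trans[OF norm_sum]) (simp add: norm_mult norm_power)
    also have "\<dots> \<le> (\<Sum>n. cmod (a n))" by (rule sum_le_suminf[OF a]) auto
    finally show "cmod (?S N t) \<le> (\<Sum>n. cmod (a n))" .
  qed simp
  have int: "(\<lambda>t. (cmod (?S N t))\<^sup>2) integrable_on {0..2 * pi}" for N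
    using has_integral_norm_trig_polynomial by blast
  note dc = dominated_convergence[where f = "\<lambda>N t. (cmod (?S N t))\<^sup>2" and g = ?g
      and h = "\<lambda>_. (\<Sum>n. cmod (a n))\<^sup>2" and S = "{0..2 * pi}"]
  have gi: "?g integrable_on {0..2 * pi}"
    by (rule dc(1)) (use int lim bound in auto)
  have "(\<lambda>N. integral {0..2 * pi} (\<lambda>t. (cmod (?S N t))\<^sup>2)) \<longlonglongrightarrow> integral {0..2 * pi} ?g"
    by (rule dc(2)) (use int lim bound in auto)
  also have "(\<lambda>N. integral {0..2 * pi} (\<lambda>t. (cmod (?S N t))\<^sup>2)) = (\<lambda>N. 2 * pi * (\<Sum>n<N. (cmod (a n))\<^sup>2))"
    by (simp add: integral_unique[OF has_integral_norm_trig_polynomial])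
  finally have "(\<lambda>N. 2 * pi * (\<Sum>n<N. (cmod (a n))\<^sup>2) / (2 * pi)) \<longlonglongrightarrow> integral {0..2 * pi} ?g / (2 * pi)"
    by (intro tendsto_divide tendsto_const) auto
  then have sums: "(\<lambda>n. (cmod (a n))\<^sup>2) sums (integral {0..2 * pi} ?g / (2 * pi))"
    by (simp add: sums_def)
  have "(\<integral>\<^sup>+t\<in>{0..2 * pi}. ennreal (?g t) \<partial>lborel) = (\<integral>\<^sup>+t. ennreal (indicator {0..2 * pi} t * ?g t) \<partial>lborel)"
    by (rule nn_integral_cong) (auto simp: indicator_def)
  also have "\<dots> = ennreal (integral {0..2 * pi} ?g)"
    by (rule nn_integral_has_integral_lebesgue) (use gi in \<open>auto intro: integrable_integral\<close>)
  also have "\<dots> = ennreal (2 * pi * (\<Sum>n. (cmod (a n))\<^sup>2))"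
    using sums_unique[OF sums] by (simp add: field_simps)
  also have "\<dots> = ennreal (2 * pi) * (\<Sum>n. ennreal ((cmod (a n))\<^sup>2))"
    using sums_summable[OF sums]
    by (subst suminf_ennreal2) (simp, assumption, rule ennreal_mult, auto intro!: suminf_nonneg)
  finally show ?thesis .
qed

text \<open>Rotation invariance allows averaging over \<open>cis t * z\<close>. Tonelli moves the
  average inside, where Parseval on each circle removes the cross terms. This replaces polar
  coordinates.\<close>

lemma nn_integral_radial_power_series:
  fixes a :: "nat \<Rightarrow> complex" and w :: "real \<Rightarrow> ennreal"
  assumes [measurable]: "w \<in> borel_measurable borel" "f \<in> borel_measurable borel"
    and f: "\<And>z. (\<lambda>n. a n * z ^ n) sums f z"
  shows "(\<integral>\<^sup>+z. w (cmod z) * ennreal ((cmod (f z))\<^sup>2) \<partial>lborel)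
    = (\<Sum>n. ennreal ((cmod (a n))\<^sup>2) * (\<integral>\<^sup>+z. w (cmod z) * ennreal (cmod z ^ (2 * n)) \<partial>lborel))"
proof -
  let ?I = "\<integral>\<^sup>+z. w (cmod z) * ennreal ((cmod (f z))\<^sup>2) \<partial>lborel"
  let ?C = "{0..2 * pi}"
  have abs: "summable (\<lambda>n. cmod (a n * z ^ n))" for z
  proof -
    \<comment> \<open>Convergence at a point of larger modulus gives absolute convergence at
      \<open>z\<close>.\<close>
    have "summable (\<lambda>n. a n * of_real (cmod z + 1) ^ n)" using f sums_summable by blast
    from powser_insidea[OF this] show ?thesis by simp
  qed
  have "ennreal (2 * pi) * ?I = (\<integral>\<^sup>+t. indicator ?C t * ?I \<partial>lborel)"
    by (simp add: nn_integral_multc)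
  also have "\<dots> = (\<integral>\<^sup>+t. \<integral>\<^sup>+z. indicator ?C t * (w (cmod z) * ennreal ((cmod (f (cis t * z)))\<^sup>2)) \<partial>lborel \<partial>lborel)"
  proof (rule nn_integral_cong)
    fix t
    have "?I = (\<integral>\<^sup>+z. w (cmod (cis t * z)) * ennreal ((cmod (f (cis t * z)))\<^sup>2) \<partial>lborel)"
      by (rule nn_integral_lborel_rotate[symmetric]) auto
    then show "indicator ?C t * ?I = (\<integral>\<^sup>+z. indicator ?C t * (w (cmod z) * ennreal ((cmod (f (cis t * z)))\<^sup>2)) \<partial>lborel)"
      by (subst nn_integral_cmult) (auto simp: norm_mult)
  qed
  also have "\<dots> = (\<integral>\<^sup>+z. \<integral>\<^sup>+t. indicator ?C t * (w (cmod z) * ennreal ((cmod (f (cis t * z)))\<^sup>2)) \<partial>lborel \<partial>lborel)"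
    by (rule lborel_pair.Fubini') (simp add: cis_conv_exp)
  also have "\<dots> = (\<integral>\<^sup>+z. (\<Sum>n. ennreal (2 * pi) * (ennreal ((cmod (a n))\<^sup>2) * (w (cmod z) * ennreal (cmod z ^ (2 * n))))) \<partial>lborel)"
  proof (rule nn_integral_cong)
    fix z
    have eq: "f (cis t * z) = (\<Sum>n. (a n * z ^ n) * cis t ^ n)" for t
      using sums_unique[OF f[of "cis t * z"]] by (simp add: power_mult_distrib mult_ac)
    have "(\<integral>\<^sup>+t. indicator ?C t * (w (cmod z) * ennreal ((cmod (f (cis t * z)))\<^sup>2)) \<partial>lborel)
        = w (cmod z) * (\<integral>\<^sup>+t\<in>?C. ennreal ((cmod (f (cis t * z)))\<^sup>2) \<partial>lborel)"
      by (subst nn_integral_cmult[symmetric]) (simp_all add: cis_conv_exp mult_ac)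
    also have "\<dots> = w (cmod z) * (ennreal (2 * pi) * (\<Sum>n. ennreal ((cmod (a n * z ^ n))\<^sup>2)))"
      unfolding eq by (simp only: nn_integral_circle_power_series[OF abs])
    also have "\<dots> = (\<Sum>n. ennreal (2 * pi) * (ennreal ((cmod (a n))\<^sup>2) * (w (cmod z) * ennreal (cmod z ^ (2 * n)))))"
      by (simp add: norm_mult norm_power power_mult_distrib ennreal_mult mult_ac power_mult[symmetric]
        flip: ennreal_suminf_cmult)
    finally show "(\<integral>\<^sup>+t. indicator ?C t * (w (cmod z) * ennreal ((cmod (f (cis t * z)))\<^sup>2)) \<partial>lborel) = \<dots>" .
  qed
  also have "\<dots> = (\<Sum>n. ennreal (2 * pi) * (ennreal ((cmod (a n))\<^sup>2) * (\<integral>\<^sup>+z. w (cmod z) * ennreal (cmod z ^ (2 * n)) \<partial>lborel)))"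
    by (simp add: nn_integral_suminf nn_integral_cmult)
  also have "\<dots> = ennreal (2 * pi) * (\<Sum>n. ennreal ((cmod (a n))\<^sup>2) * (\<integral>\<^sup>+z. w (cmod z) * ennreal (cmod z ^ (2 * n)) \<partial>lborel))"
    by simp
  finally show ?thesis
    by (simp add: ennreal_mult_cancel_left)
qed

subsection \<open>Mellin moments of the Macdonald function\<close>

text \<open>Rescaling \<open>t\<close> by \<open>c\<close> in Euler's integral for
  \<open>Gamma p\<close>. It is applied with \<open>c = cosh u\<close>.\<close>

lemma nn_integral_powr_exp:
  fixes p c :: real
  assumes "p > 0" "c > 0"
  shows "(\<integral>\<^sup>+t\<in>{0..}. ennreal (t powr (p - 1) * exp (- (t * c))) \<partial>lborel) = ennreal (Gamma p * c powr (- p))"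
proof -
  let ?f = "\<lambda>t. ennreal (indicator {0..} t * t powr (p - 1) / exp t)"
  have "ennreal (Gamma p) = ennreal \<bar>c\<bar> * (\<integral>\<^sup>+t. ?f (0 + c * t) \<partial>lborel)"
    unfolding Gamma_conv_nn_integral_real[OF assms(1)]
    by (rule nn_integral_real_affine) (use assms in auto)
  also have "\<dots> = (\<integral>\<^sup>+t. ennreal c * ?f (c * t) \<partial>lborel)"
    using assms by (simp add: nn_integral_cmult)
  also have "\<dots> = (\<integral>\<^sup>+t. ennreal (c powr p) * (ennreal (t powr (p - 1) * exp (- (t * c))) * indicator {0..} t) \<partial>lborel)"
  proof (rule nn_integral_cong)
    fix t
    have "c * c powr (p - 1) = c powr p"
      using assms by (metis powr_mult_base less_eq_real_def add_diff_cancel_left' diff_add_cancel add.commute)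
    then show "ennreal c * ?f (c * t) = ennreal (c powr p) * (ennreal (t powr (p - 1) * exp (- (t * c))) * indicator {0..} t)"
      using assms
      by (auto simp: indicator_def zero_le_mult_iff powr_mult exp_minus field_simps simp flip: ennreal_mult)
  qed
  also have "\<dots> = ennreal (c powr p) * (\<integral>\<^sup>+t\<in>{0..}. ennreal (t powr (p - 1) * exp (- (t * c))) \<partial>lborel)"
    by (simp add: nn_integral_cmult)
  finally have "ennreal (c powr (- p)) * ennreal (Gamma p) = 
     ennreal (c powr (- p)) * ennreal (c powr p) * (\<integral>\<^sup>+t\<in>{0..}. ennreal (t powr (p - 1) * exp (- (t * c))) \<partial>lborel)"
    by (simp add: mult.assoc)
  also have "ennreal (c powr (- p)) * ennreal (c powr p) = 1"
    using assms by (simp add: powr_minus flip: ennreal_mult)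
  finally show ?thesis using assms
    by (simp add: ennreal_mult' mult.commute)
qed

section \<open>Hyperbolic integrals and their recurrence\<close>

lemma borel_measurable_cosh [measurable (raw)]:
  "f \<in> borel_measurable M \<Longrightarrow> (\<lambda>x. cosh (f x :: real)) \<in> borel_measurable M"
  unfolding cosh_def by simp

text \<open>What remains of the Mellin transform of \<open>macdonald_K \<alpha>\<close> at
  \<open>p\<close> once the variable \<open>t\<close> has been integrated out and the factor
  \<open>Gamma p\<close> split off.\<close>

definition cosh_moment :: "real \<Rightarrow> real \<Rightarrow> real" where
  "cosh_moment \<alpha> p = (LBINT u:{0..}. cosh (\<alpha> * u) * cosh u powr (- p))"

lemma cosh_abs_le_exp: "cosh (x::real) \<le> exp \<bar>x\<bar>"
  by (cases "x \<ge> 0") (simp_all add: cosh_def)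

lemma abs_sinh_le_cosh: "\<bar>sinh (x::real)\<bar> \<le> cosh x"
  using cosh_real_nonneg[of x] abs_le_square_iff[of "sinh x" "cosh x"] cosh_square_eq[of x]
  by simp

lemma cosh_powr_neg_le:
  fixes u p :: real
  assumes "u \<ge> 0" "p \<ge> 0"
  shows "cosh u powr (- p) \<le> 2 powr p * exp (- (p * u))"
proof -
  have "cosh u powr (- p) \<le> (exp u / 2) powr (- p)"
    by (rule powr_mono2') (use assms in \<open>auto simp: cosh_def\<close>)
  also have "\<dots> = 2 powr p * exp (- (p * u))"
    by (simp add: powr_divide powr_minus exp_powr_real exp_minus field_simps)
  finally show ?thesis .
qed

text \<open>This exponential majorant serves twice: for integrability of the moment, and for the
  vanishing of the boundary term at infinity in the integration by parts.\<close>

lemma cosh_cosh_powr_le: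
  fixes u p \<alpha> :: real
  assumes "u \<ge> 0" "p > \<bar>\<alpha>\<bar>"
  shows "cosh (\<alpha> * u) * cosh u powr (- p) \<le> 2 powr p * exp (- ((p - \<bar>\<alpha>\<bar>) * u))"
proof -
  have "cosh (\<alpha> * u) * cosh u powr (- p) \<le> exp \<bar>\<alpha> * u\<bar> * (2 powr p * exp (- (p * u)))"
    by (intro mult_mono cosh_abs_le_exp cosh_powr_neg_le) (use assms in auto)
  also have "\<dots> = 2 powr p * exp (- ((p - \<bar>\<alpha>\<bar>) * u))"
    using assms by (simp add: abs_mult exp_diff exp_minus field_simps flip: exp_add)
  finally show ?thesis .
qed

lemma integrable_cosh_moment:
  fixes p \<alpha> :: real
  assumes "p > \<bar>\<alpha>\<bar>"
  shows "set_integrable lborel {0..} (\<lambda>u. cosh (\<alpha> * u) * cosh u powr (- p))"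
proof (rule set_integrable_bound)
  let ?c = "p - \<bar>\<alpha>\<bar>"
  have "integrable lborel (\<lambda>u. (exp (- (?c * u))) * indicator {0..} u)"
  proof (rule integrableI_nonneg)
    have "(\<integral>\<^sup>+u. ennreal (exp (- (?c * u)) * indicator {0..} u) \<partial>lborel)
        = (\<integral>\<^sup>+u\<in>{0..}. ennreal (exp (- (?c * u))) \<partial>lborel)"
      by (rule nn_integral_cong) (auto simp: indicator_def)
    also have "\<dots> = ennreal (0 - (- exp (- (?c * 0)) / ?c))"
    proof (rule nn_integral_FTC_atLeast)
      show "((\<lambda>u. - exp (- (?c * u)) / ?c) has_real_derivative exp (- (?c * x))) (at x)" for x
      proof -
        have "((\<lambda>u. - exp (- (c * u)) / c) has_real_derivative exp (- (c * x))) (at x)" if "c > 0" for c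
          using that by (auto intro!: derivative_eq_intros)
        then show ?thesis using assms by simp
      qed
      show "((\<lambda>u. - exp (- (?c * u)) / ?c) \<longlongrightarrow> 0) at_top"
        using assms by real_asymp
    qed auto
    finally show "(\<integral>\<^sup>+u. ennreal (exp (- (?c * u)) * indicator {0..} u) \<partial>lborel) < \<infinity>"
      by simp
  qed auto
  then have "set_integrable lborel {0..} (\<lambda>u. exp (- (?c * u)))"
    by (simp add: set_integrable_def mult.commute)
  then show "set_integrable lborel {0..} (\<lambda>u. 2 powr p * exp (- (?c * u)))"
    by (intro set_integrable_mult_right impI)
  show "AE u in lborel. u \<in> {0..} \<longrightarrow> norm (cosh (\<alpha> * u) * cosh u powr (- p))
      \<le> norm (2 powr p * exp (- (?c * u)))"
    using cosh_cosh_powr_le[OF _ assms] by (auto simp: abs_mult)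
qed (simp add: set_borel_measurable_def)

lemma cosh_moment_minus: "cosh_moment (- \<alpha>) p = cosh_moment \<alpha> p"
  by (simp add: cosh_moment_def)

lemma cosh_moment_nonneg: "cosh_moment \<alpha> p \<ge> 0"
  unfolding cosh_moment_def set_lebesgue_integral_def by (rule integral_nonneg_AE) auto

lemma nn_integral_cosh_moment:
  assumes "p > \<bar>\<alpha>\<bar>"
  shows "(\<integral>\<^sup>+u\<in>{0..}. ennreal (cosh (\<alpha> * u) * cosh u powr (- p)) \<partial>lborel) = ennreal (cosh_moment \<alpha> p)"
  unfolding cosh_moment_def
  by (rule nn_integral_set_ennreal[THEN trans]) 
    (use integrable_cosh_moment[OF assms] in \<open>simp add: set_lebesgue_integral_def set_integrable_def nn_integral_eq_integral mult.commute\<close>)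

text \<open>By the addition formula for \<open>cosh ((\<alpha> - 1) * u)\<close>, the difference of
  the two integrands is the derivative of \<open>sinh (\<alpha> * u) * cosh u powr (- p)\<close>.
  This primitive vanishes at 0 because of \<open>sinh\<close> and at infinity because
  \<open>p > \<bar>\<alpha>\<bar>\<close>.\<close>

lemma cosh_moment_rec:
  assumes p: "p > \<bar>\<alpha>\<bar>"
  shows "p * cosh_moment (\<alpha> - 1) (p + 1) = (p - \<alpha>) * cosh_moment \<alpha> p"
proof -
  let ?f = "\<lambda>u. p * (cosh ((\<alpha> - 1) * u) * cosh u powr (- (p + 1)))"
  let ?g = "\<lambda>u. (p - \<alpha>) * (cosh (\<alpha> * u) * cosh u powr (- p))"
  let ?F = "\<lambda>u. sinh (\<alpha> * u) * cosh u powr (- p)"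
  have f: "set_integrable lborel {0..} ?f"
    using p by (intro set_integrable_mult_right impI integrable_cosh_moment) linarith
  have g: "set_integrable lborel {0..} ?g"
    using p by (intro set_integrable_mult_right impI integrable_cosh_moment)
  \<comment> \<open>The closed half-line and the open interval differ by the null set
    \<open>{0}\<close>.\<close>
  have "(LBINT u:{0..}. ?f u - ?g u) = (LBINT u=0..\<infinity>. ?f u - ?g u)"
    by (simp add: interval_lebesgue_integral_0_infty set_lebesgue_integral_def)
      (rule integral_cong_AE, auto intro!: AE_I[of _ _ "{0}"] simp: indicator_def)
  also have "\<dots> = 0 - 0"
  proof (rule interval_integral_FTC_integrable)
    show "(?F has_vector_derivative ?f u - ?g u) (at u)" for u
    proof -
      define w where "w = cosh u powr (- p - 1)"
      have w: "cosh u powr (- (p + 1)) = w" by (simp add: w_def)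
      have wc: "cosh u powr (- p) = w * cosh u"
        using powr_mult_base[of "cosh u" "- p - 1"] cosh_real_nonneg[of u] by (simp add: w_def mult.commute)
      have c: "cosh ((\<alpha> - 1) * u) = cosh (\<alpha> * u) * cosh u - sinh (\<alpha> * u) * sinh u"
        using cosh_diff[of "\<alpha> * u" u] by (simp add: algebra_simps)
      have "(?F has_real_derivative \<alpha> * cosh (\<alpha> * u) * cosh u powr (- p)
          + sinh (\<alpha> * u) * ((- p) * w * sinh u)) (at u)"
        unfolding w_def by (auto intro!: derivative_eq_intros simp: has_field_derivative_powr)
      also have "\<alpha> * cosh (\<alpha> * u) * cosh u powr (- p)
          + sinh (\<alpha> * u) * ((- p) * w * sinh u) = ?f u - ?g u"
        unfolding c w wc by (simp add: algebra_simps)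
      finally show ?thesis by (simp add: has_real_derivative_iff_has_vector_derivative)
    qed
    show "isCont (\<lambda>u. ?f u - ?g u) u" for u by (intro continuous_intros) auto
    have "set_integrable lborel {0..} (\<lambda>u. ?f u - ?g u)"
      by (rule set_integral_diff(1)[OF f g])
    then show "set_integrable lborel (einterval 0 \<infinity>) (\<lambda>u. ?f u - ?g u)"
      by (rule set_integrable_subset) (auto simp: einterval_def)
    have "isCont ?F 0" by (intro continuous_intros) auto
    then have "(?F \<longlongrightarrow> 0) (at_right 0)"
      unfolding isCont_def by (simp add: filterlim_at_split)
    then show "((?F \<circ> real_of_ereal) \<longlongrightarrow> 0) (at_right 0)"
      by (simp add: zero_ereal_def ereal_tendsto_simps)
    have "((\<lambda>u. 2 powr p * exp (- ((p - \<bar>\<alpha>\<bar>) * u))) \<longlongrightarrow> 0) at_top"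
      using p by real_asymp
    then have "(?F \<longlongrightarrow> 0) at_top"
    proof (rule Lim_null_comparison[rotated])
      show "\<forall>\<^sub>F u in at_top. norm (?F u) \<le> 2 powr p * exp (- ((p - \<bar>\<alpha>\<bar>) * u))"
        using eventually_ge_at_top[of 0]
      proof eventually_elim
        case (elim u)
        have "norm (?F u) \<le> cosh (\<alpha> * u) * cosh u powr (- p)"
          by (auto simp: abs_mult intro!: mult_right_mono abs_sinh_le_cosh)
        also note cosh_cosh_powr_le[OF elim p]
        finally show ?case .
      qed
    qed
    then show "((?F \<circ> real_of_ereal) \<longlongrightarrow> 0) (at_left \<infinity>)"
      by (simp add: ereal_tendsto_simps)
  qed simp
  finally have "(LBINT u:{0..}. ?f u) = (LBINT u:{0..}. ?g u)"
    using set_integral_diff(2)[OF f g] by simp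
  then show ?thesis by (simp add: cosh_moment_def)
qed

section \<open>The Mellin transform of the Macdonald function\<close>

lemma macdonald_K_measurable [measurable]: "macdonald_K \<alpha> \<in> borel_measurable borel"
  unfolding macdonald_K_def[abs_def] set_lebesgue_integral_def by measurable

lemma macdonald_K_nonneg: "macdonald_K \<alpha> x \<ge> 0"
  unfolding macdonald_K_def set_lebesgue_integral_def by (rule integral_nonneg_AE) auto

text \<open>For \<open>p > \<bar>\<alpha>\<bar>\<close> this is the integral of
  \<open>t powr (p - 1) * macdonald_K \<alpha> t\<close> over the half-line, as
  \<open>nn_integral_powr_macdonald_K\<close> shows. The product form lets recurrence and symmetry
  be read off from \<open>cosh_moment\<close>.\<close>

definition macdonald_mellin :: "real \<Rightarrow> real \<Rightarrow> real" where
  "macdonald_mellin \<alpha> p = Gamma p * cosh_moment \<alpha> p"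

lemma macdonald_mellin_nonneg: "p > 0 \<Longrightarrow> macdonald_mellin \<alpha> p \<ge> 0"
  by (simp add: macdonald_mellin_def cosh_moment_nonneg)

lemma macdonald_mellin_minus: "macdonald_mellin (- \<alpha>) p = macdonald_mellin \<alpha> p"
  by (simp add: macdonald_mellin_def cosh_moment_minus)

text \<open>The factor \<open>p\<close> in \<open>cosh_moment_rec\<close> is absorbed by
  \<open>Gamma (p + 1) = p * Gamma p\<close>.\<close>

lemma macdonald_mellin_rec:
  assumes "p > \<bar>\<alpha>\<bar>"
  shows "macdonald_mellin (\<alpha> - 1) (p + 1) = (p - \<alpha>) * macdonald_mellin \<alpha> p"
proof -
  have "Gamma (p + 1) = p * Gamma p"
    using assms by (intro Gamma_plus1) (auto elim!: nonpos_Ints_cases)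
  then show ?thesis
    using cosh_moment_rec[OF assms] by (simp add: macdonald_mellin_def mult_ac)
qed

text \<open>Tonelli allows integrating in \<open>t\<close> first: for each \<open>u\<close> this is
  a Gamma integral with rate \<open>cosh u\<close>, and the remaining integral in \<open>u\<close>
  is \<open>cosh_moment \<alpha> p\<close>.\<close>

lemma nn_integral_powr_macdonald_K:
  assumes p: "p > \<bar>\<alpha>\<bar>"
  shows "(\<integral>\<^sup>+t\<in>{0..}. ennreal (t powr (p - 1) * macdonald_K \<alpha> t) \<partial>lborel)
    = ennreal (macdonald_mellin \<alpha> p)"
proof -
  let ?k = "\<lambda>t u. exp (- (t * cosh u)) * cosh (\<alpha> * u)"
  let ?h = "\<lambda>t u. ennreal (indicator {0..} t * t powr (p - 1) * (indicator {0..} u * ?k t u))"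
  have p0: "p > 0" using p by linarith
  have "(\<integral>\<^sup>+t. \<integral>\<^sup>+u. ?h t u \<partial>lborel \<partial>lborel) = (\<integral>\<^sup>+u. \<integral>\<^sup>+t. ?h t u \<partial>lborel \<partial>lborel)"
    by (rule lborel_pair.Fubini') measurable
  also have "\<dots> = (\<integral>\<^sup>+u. ennreal (Gamma p) * (ennreal (cosh (\<alpha> * u) * cosh u powr (- p)) * indicator {0..} u) \<partial>lborel)"
  proof (rule nn_integral_cong)
    fix u :: real
    have "(\<integral>\<^sup>+t. ?h t u \<partial>lborel) = (\<integral>\<^sup>+t. ennreal (indicator {0..} u * cosh (\<alpha> * u)) * (ennreal (t powr (p - 1) * exp (- (t * cosh u))) * indicator {0..} t) \<partial>lborel)"
      by (rule nn_integral_cong) (auto simp: indicator_def mult_ac simp flip: ennreal_mult)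
    also have "\<dots> = ennreal (indicator {0..} u * cosh (\<alpha> * u)) * ennreal (Gamma p * cosh u powr (- p))"
      by (simp add: nn_integral_cmult nn_integral_powr_exp p0)
    also have "\<dots> = ennreal (Gamma p) * (ennreal (cosh (\<alpha> * u) * cosh u powr (- p)) * indicator {0..} u)"
      using Gamma_real_pos[OF p0] by (auto simp: indicator_def mult_ac simp flip: ennreal_mult)
    finally show "(\<integral>\<^sup>+t. ?h t u \<partial>lborel) = ennreal (Gamma p) * (ennreal (cosh (\<alpha> * u) * cosh u powr (- p)) * indicator {0..} u)" .
  qed
  also have "\<dots> = ennreal (macdonald_mellin \<alpha> p)"
    using Gamma_real_pos[OF p0] 
    by (subst nn_integral_cmult, measurable)
      (subst nn_integral_cosh_moment[OF p], simp add: macdonald_mellin_def ennreal_mult')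
  finally have total: "(\<integral>\<^sup>+t. \<integral>\<^sup>+u. ?h t u \<partial>lborel \<partial>lborel) = ennreal (macdonald_mellin \<alpha> p)" .
  \<comment> \<open>Finiteness of the double integral gives the convergence of the integral defining
    \<open>macdonald_K \<alpha> t\<close> for almost every \<open>t\<close>, which is all that is needed.\<close>
  then have "AE t in lborel. (\<integral>\<^sup>+u. ?h t u \<partial>lborel) \<noteq> \<infinity>"
    by (intro nn_integral_noteq_infinite) auto
  \<comment> \<open>Discarding the null point 0 leaves only negative \<open>t\<close> in the second
    case below, where the indicator vanishes.\<close>
  moreover have "AE t in lborel. t \<noteq> (0::real)" by (rule AE_lborel_singleton)
  ultimately have "AE t in lborel. ennreal (t powr (p - 1) * macdonald_K \<alpha> t) * indicator {0..} t = (\<integral>\<^sup>+u. ?h t u \<partial>lborel)"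
  proof eventually_elim
    case (elim t)
    show ?case
    proof (cases "t > 0")
      case True
      then have "integrable lborel (\<lambda>u. t powr (p - 1) * (indicator {0..} u * ?k t u))"
        using elim by (intro integrableI_nonneg) (auto simp: less_top)
      moreover from this have "(\<integral>\<^sup>+u. ?h t u \<partial>lborel) = ennreal (LINT u|lborel. t powr (p - 1) * (indicator {0..} u * ?k t u))"
        using True by (subst nn_integral_eq_integral[symmetric]) auto
      ultimately show ?thesis using True
        by (simp add: macdonald_K_def set_lebesgue_integral_def)
    next
      case False
      then show ?thesis using elim by (simp add: indicator_def)
    qed
  qed
  then have "(\<integral>\<^sup>+t\<in>{0..}. ennreal (t powr (p - 1) * macdonald_K \<alpha> t) \<partial>lborel) = (\<integral>\<^sup>+t. \<integral>\<^sup>+u. ?h t u \<partial>lborel \<partial>lborel)"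
    by (rule nn_integral_cong_AE)
  with total show ?thesis by simp
qed

text \<open>The pointwise inequality \<open>2 * t \<le> l + t\<^sup>2 / l\<close> is integrated
  against \<open>t powr (p - 2) * macdonald_K \<alpha> t\<close>. The condition on \<open>p\<close>
  makes the lowest of the three Mellin integrals converge.\<close>

lemma macdonald_mellin_amgm:
  assumes "p - 1 > \<bar>\<alpha>\<bar>" "l > 0"
  shows "2 * macdonald_mellin \<alpha> p \<le> l * macdonald_mellin \<alpha> (p - 1) + macdonald_mellin \<alpha> (p + 1) / l"
proof -
  let ?w = "\<lambda>p t. ennreal (t powr (p - 1) * macdonald_K \<alpha> t) * indicator {0..} t"
  have "ennreal 2 * ennreal (macdonald_mellin \<alpha> p) = ennreal 2 * (\<integral>\<^sup>+t. ?w p t \<partial>lborel)"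
    using assms by (subst nn_integral_powr_macdonald_K) auto
  also have "\<dots> = (\<integral>\<^sup>+t. ennreal 2 * ?w p t \<partial>lborel)"
    by (rule nn_integral_cmult[symmetric]) measurable
  also have "\<dots> \<le> (\<integral>\<^sup>+t. ennreal l * ?w (p - 1) t + ennreal (1 / l) * ?w (p + 1) t \<partial>lborel)"
  proof (rule nn_integral_mono)
    fix t :: real
    show "ennreal 2 * ?w p t \<le> ennreal l * ?w (p - 1) t + ennreal (1 / l) * ?w (p + 1) t"
    proof (cases "t > 0")
      case True
      have "2 * t \<le> l + t\<^sup>2 / l"
        using assms(2) zero_le_power2[of "t - l"] by (simp add: field_simps power2_eq_square)
      then have "2 * t * (t powr (p - 2) * macdonald_K \<alpha> t) \<le> (l + t\<^sup>2 / l) * (t powr (p - 2) * macdonald_K \<alpha> t)"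
        by (rule mult_right_mono) (simp add: macdonald_K_nonneg)
      moreover have pw: "t powr (p - 1) = t * t powr (p - 2)" "t powr p = t\<^sup>2 * t powr (p - 2)"
        using True powr_add[of t 1 "p - 2"] powr_add[of t 2 "p - 2"] by simp_all
      ultimately have "2 * (t powr (p - 1) * macdonald_K \<alpha> t) \<le> l * (t powr (p - 2) * macdonald_K \<alpha> t) + 1 / l * (t powr p * macdonald_K \<alpha> t)"
        by (simp add: pw algebra_simps)
      then show ?thesis using True assms macdonald_K_nonneg[of \<alpha> t]
        by (simp add: ennreal_leI del: ennreal_numeral flip: ennreal_mult ennreal_plus)
    qed (use assms in \<open>auto simp: indicator_def\<close>)
  qed
  also have "\<dots> = ennreal l * ennreal (macdonald_mellin \<alpha> (p - 1)) + ennreal (1 / l) * ennreal (macdonald_mellin \<alpha> (p + 1))"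
    using assms by (subst nn_integral_add; simp add: nn_integral_cmult nn_integral_powr_macdonald_K[of _ "p - 1", simplified] nn_integral_powr_macdonald_K[of _ "p + 1", simplified])
  finally have "ennreal (2 * macdonald_mellin \<alpha> p)
      \<le> ennreal (l * macdonald_mellin \<alpha> (p - 1) + macdonald_mellin \<alpha> (p + 1) / l)"
    using assms by (simp add: macdonald_mellin_nonneg del: ennreal_numeral flip: ennreal_mult ennreal_plus)
  then show ?thesis
    using assms by (subst (asm) ennreal_le_iff) (auto simp: macdonald_mellin_nonneg)
qed

subsection \<open>Moments of the two weights\<close>

text \<open>With \<open>t\<close> the squared modulus, the powers of \<open>cmod z\<close> combine
  to \<open>t powr (p - 1)\<close> for \<open>p = n + k + \<mu> + 3/2\<close>, and \<open>pi\<close>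
  comes from the radial formula. The case \<open>k = 0\<close> yields norms and \<open>k = 1\<close>
  yields deformed energies.\<close>

lemma nn_integral_macdonald_weight:
  assumes f: "f \<in> borel_measurable borel" "\<And>z. (\<lambda>n. a n * z ^ n) sums f z"
    and c: "c \<ge> 0" and \<mu>: "\<mu> + 3/2 > \<bar>\<alpha>\<bar>"
  shows "(\<integral>\<^sup>+z. ennreal (c * macdonald_K \<alpha> ((cmod z)\<^sup>2) * cmod z powr (2 * \<mu> + 1))
        * ennreal (cmod z ^ (2 * k) * (cmod (f z))\<^sup>2) \<partial>lborel)
    = (\<Sum>n. ennreal ((cmod (a n))\<^sup>2) * ennreal (c * pi * macdonald_mellin \<alpha> (real (n + k) + \<mu> + 3/2)))"
proof -
  define w where "w r = ennreal (c * macdonald_K \<alpha> (r\<^sup>2) * r powr (2 * \<mu> + 1)) * ennreal (r ^ (2 * k))" for r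
  have [measurable]: "w \<in> borel_measurable borel" unfolding w_def[abs_def] by measurable
  have "(\<integral>\<^sup>+z. ennreal (c * macdonald_K \<alpha> ((cmod z)\<^sup>2) * cmod z powr (2 * \<mu> + 1))
        * ennreal (cmod z ^ (2 * k) * (cmod (f z))\<^sup>2) \<partial>lborel)
      = (\<integral>\<^sup>+z. w (cmod z) * ennreal ((cmod (f z))\<^sup>2) \<partial>lborel)"
    by (simp add: w_def ennreal_mult mult.assoc)
  also have "\<dots> = (\<Sum>n. ennreal ((cmod (a n))\<^sup>2) * (\<integral>\<^sup>+z. w (cmod z) * ennreal (cmod z ^ (2 * n)) \<partial>lborel))"
    by (rule nn_integral_radial_power_series[OF _ f]) measurable
  also have "(\<lambda>n. \<integral>\<^sup>+z. w (cmod z) * ennreal (cmod z ^ (2 * n)) \<partial>lborel)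
      = (\<lambda>n. ennreal (c * pi * macdonald_mellin \<alpha> (real (n + k) + \<mu> + 3/2)))"
  proof
    fix n
    let ?p = "real (n + k) + \<mu> + 3/2"
    have p: "?p > \<bar>\<alpha>\<bar>" using \<mu> by simp
    define v where "v t = ennreal (c * (t powr (?p - 1) * macdonald_K \<alpha> t))" for t
    have [measurable]: "v \<in> borel_measurable borel" unfolding v_def[abs_def] by measurable
    have wv: "w (cmod z) * ennreal (cmod z ^ (2 * n)) = v ((cmod z)\<^sup>2)" for z
    \<comment> \<open>At the origin both sides are 0 since \<open>0 powr x = 0\<close>, whatever
      value \<open>macdonald_K\<close> has there.\<close>
    proof (cases "z = 0")
      case False
      then have r: "cmod z > 0" by simp
      have "cmod z powr (2 * \<mu> + 1) * (cmod z ^ (2 * k) * cmod z ^ (2 * n)) = ((cmod z)\<^sup>2) powr (?p - 1)"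
        using r by (simp add: powr_realpow[symmetric] powr_powr powr_add[symmetric] algebra_simps
            del: powr_realpow powr_numeral)
      then show ?thesis using c macdonald_K_nonneg[of \<alpha> "(cmod z)\<^sup>2"]
        by (simp add: w_def v_def mult_ac flip: ennreal_mult)
    qed (simp add: w_def v_def)
    have "(\<integral>\<^sup>+z. w (cmod z) * ennreal (cmod z ^ (2 * n)) \<partial>lborel) = ennreal pi * (\<integral>\<^sup>+t\<in>{0..}. v t \<partial>lborel)"
      unfolding wv by (rule nn_integral_complex_radial) measurable
    also have "(\<integral>\<^sup>+t\<in>{0..}. v t \<partial>lborel)
        = (\<integral>\<^sup>+t. ennreal c * (ennreal (t powr (?p - 1) * macdonald_K \<alpha> t) * indicator {0..} t) \<partial>lborel)"
      using c by (simp add: v_def ennreal_mult macdonald_K_nonneg mult_ac)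
    also have "\<dots> = ennreal c * ennreal (macdonald_mellin \<alpha> ?p)"
      by (subst nn_integral_cmult, measurable) (simp only: nn_integral_powr_macdonald_K[OF p])
    also have "ennreal pi * (ennreal c * ennreal (macdonald_mellin \<alpha> ?p)) = ennreal (c * pi * macdonald_mellin \<alpha> ?p)"
      using c macdonald_mellin_nonneg[of ?p \<alpha>] p by (simp add: mult_ac flip: ennreal_mult)
    finally show "(\<integral>\<^sup>+z. w (cmod z) * ennreal (cmod z ^ (2 * n)) \<partial>lborel)
        = ennreal (c * pi * macdonald_mellin \<alpha> ?p)" .
  qed
  finally show ?thesis .
qed

text \<open>The normalising constant of both densities times the \<open>pi\<close> of the radial
  formula, left uncancelled so that it unfolds to the \<open>c * pi\<close> of
  \<open>nn_integral_macdonald_weight\<close>.\<close>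

definition moment_const :: "real \<Rightarrow> real" where
  "moment_const \<mu> = 2 powr (1/2 - \<mu>) / (pi * Gamma (\<mu> + 1/2)) * pi"

text \<open>At \<open>n = 0\<close> the Mellin exponent \<open>\<mu> + 3/2\<close> exceeds
  \<open>\<bar>\<mu> - 1/2\<bar>\<close> exactly when \<open>\<mu> > - 1/2\<close>.\<close>

definition moment_e :: "real \<Rightarrow> nat \<Rightarrow> real" where
  "moment_e \<mu> n = moment_const \<mu> * macdonald_mellin (\<mu> - 1/2) (real n + \<mu> + 3/2)"

definition moment_o :: "real \<Rightarrow> nat \<Rightarrow> real" where
  "moment_o \<mu> n = moment_const \<mu> * macdonald_mellin (\<mu> + 1/2) (real n + \<mu> + 3/2)"

context
  fixes \<mu> :: real
  assumes \<mu>: "\<mu> > - 1/2"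
begin

lemma moment_const_nonneg: "moment_const \<mu> \<ge> 0"
  using \<mu> Gamma_real_pos[of "\<mu> + 1/2"] by (simp add: moment_const_def)

lemma moment_e_nonneg: "moment_e \<mu> n \<ge> 0"
  using \<mu> by (simp add: moment_e_def moment_const_nonneg macdonald_mellin_nonneg)

lemma moment_o_nonneg: "moment_o \<mu> n \<ge> 0"
  using \<mu> by (simp add: moment_o_def moment_const_nonneg macdonald_mellin_nonneg)

text \<open>Lowering the order from \<open>\<mu> + 1/2\<close> to \<open>\<mu> - 1/2\<close> passes
  from the odd to the even weight, with factor \<open>p - (\<mu> + 1/2) = n + 1\<close>.\<close>

lemma moment_e_Suc: "moment_e \<mu> (Suc n) = (real n + 1) * moment_o \<mu> n"
  using macdonald_mellin_rec[of "\<mu> + 1/2" "real n + \<mu> + 3/2"] \<mu>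
  by (simp add: moment_e_def moment_o_def algebra_simps)

text \<open>The Macdonald function is even in its order, so the same recurrence applies at order
  \<open>- (\<mu> - 1/2)\<close>, which it lowers to \<open>- (\<mu> + 1/2)\<close>.\<close>

lemma moment_o_Suc: "moment_o \<mu> (Suc n) = (real n + 2 * \<mu> + 1) * moment_e \<mu> n"
proof -
  have "macdonald_mellin (- (\<mu> - 1/2) - 1) (real n + \<mu> + 3/2 + 1)
      = (real n + 2 * \<mu> + 1) * macdonald_mellin (- (\<mu> - 1/2)) (real n + \<mu> + 3/2)"
    using macdonald_mellin_rec[of "- (\<mu> - 1/2)" "real n + \<mu> + 3/2"] \<mu> by (simp add: algebra_simps)
  moreover have "- (\<mu> - 1/2) - 1 = - (\<mu> + 1/2)" by simp
  ultimately have "macdonald_mellin (\<mu> + 1/2) (real n + \<mu> + 3/2 + 1)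
      = (real n + 2 * \<mu> + 1) * macdonald_mellin (\<mu> - 1/2) (real n + \<mu> + 3/2)"
    by (simp only: macdonald_mellin_minus)
  then show ?thesis by (simp add: moment_e_def moment_o_def algebra_simps)
qed

section \<open>Growth of consecutive moments\<close>

lemma moment_e_amgm: "l > 0 \<Longrightarrow> 2 * moment_e \<mu> (Suc n) \<le> l * moment_e \<mu> n + moment_e \<mu> (Suc (Suc n)) / l"
  using mult_left_mono[OF macdonald_mellin_amgm[of "\<mu> - 1/2" "real n + \<mu> + 5/2" l] moment_const_nonneg] \<mu>
  by (simp add: moment_e_def algebra_simps)

lemma moment_o_amgm: "l > 0 \<Longrightarrow> 2 * moment_o \<mu> (Suc n) \<le> l * moment_o \<mu> n + moment_o \<mu> (Suc (Suc n)) / l"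
  using mult_left_mono[OF macdonald_mellin_amgm[of "\<mu> + 1/2" "real n + \<mu> + 5/2" l] moment_const_nonneg] \<mu>
  by (simp add: moment_o_def algebra_simps)

text \<open>Take \<open>l = n + 1\<close>; two recurrence steps turn the moment at
  \<open>n + 2\<close> into \<open>(n + 2) * (n + 2 * \<mu> + 1)\<close> times the moment at
  \<open>n\<close>. This bounds the deformed energy by norm plus Dirichlet energy on even
  degrees.\<close>

lemma moment_e_Suc_le: "moment_e \<mu> (Suc n) \<le> (2 + 2 * \<bar>\<mu>\<bar>) * (1 + real n) * moment_e \<mu> n"
proof -
  have "2 * moment_e \<mu> (Suc n) \<le> (real n + 1) * moment_e \<mu> n
      + (real n + 2) * ((real n + 2 * \<mu> + 1) * moment_e \<mu> n) / (real n + 1)"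
    using moment_e_amgm[of "real n + 1" n] by (simp add: moment_e_Suc[of "Suc n"] moment_o_Suc add.commute)
  also have "\<dots> = ((real n + 1) + (real n + 2) / (real n + 1) * (real n + 2 * \<mu> + 1)) * moment_e \<mu> n"
    by (simp add: algebra_simps)
  also have "\<dots> \<le> (2 * ((2 + 2 * \<bar>\<mu>\<bar>) * (1 + real n))) * moment_e \<mu> n"
  proof (rule mult_right_mono[OF _ moment_e_nonneg])
    \<comment> \<open>The quotient is at most 2, and the other factor is non-negative because
      \<open>\<mu> > - 1/2\<close>.\<close>
    have "(real n + 2) / (real n + 1) * (real n + 2 * \<mu> + 1) \<le> 2 * (real n + 2 * \<bar>\<mu>\<bar> + 1)"
      using \<mu> by (intro mult_mono) (auto simp: field_simps)
    then have "(real n + 1) + (real n + 2) / (real n + 1) * (real n + 2 * \<mu> + 1)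
        \<le> (real n + 1) + 2 * (real n + 2 * \<bar>\<mu>\<bar> + 1)"
      by (rule add_left_mono)
    also have "\<dots> \<le> 2 * ((2 + 2 * \<bar>\<mu>\<bar>) * (1 + real n))"
      by (simp add: algebra_simps)
    finally show "(real n + 1) + (real n + 2) / (real n + 1) * (real n + 2 * \<mu> + 1)
        \<le> 2 * ((2 + 2 * \<bar>\<mu>\<bar>) * (1 + real n))" .
  qed
  finally show ?thesis by simp
qed

text \<open>Again \<open>l = n + 1\<close>, which now cancels against the factor
  \<open>n + 1\<close> of the moment at \<open>n + 2\<close>. The bound is phrased through
  \<open>n + 2 * \<mu>\<close>, the Dirichlet coefficient for odd \<open>n\<close>; it is
  non-negative for \<open>n \<ge> 1\<close>.\<close>

lemma moment_o_Suc_le: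
  assumes "n \<ge> 1"
  shows "moment_o \<mu> (Suc n) \<le> (3 + 2 * \<bar>\<mu>\<bar>) * (1 + (real n + 2 * \<mu>)) * moment_o \<mu> n"
proof -
  have "2 * moment_o \<mu> (Suc n) \<le> (real n + 1) * moment_o \<mu> n + (real n + 2 * \<mu> + 2) * moment_o \<mu> n"
  proof -
    have "moment_o \<mu> (Suc (Suc n)) = (real n + 1) * ((real n + 2 * \<mu> + 2) * moment_o \<mu> n)"
      by (simp add: moment_o_Suc[of "Suc n"] moment_e_Suc algebra_simps)
    then show ?thesis using moment_o_amgm[of "real n + 1" n] by simp
  qed
  also have "\<dots> = (2 * (real n + 2 * \<mu>) + (3 - 2 * \<mu>)) * moment_o \<mu> n"
    by (simp add: algebra_simps)
  also have "\<dots> \<le> (2 * ((3 + 2 * \<bar>\<mu>\<bar>) * (1 + (real n + 2 * \<mu>)))) * moment_o \<mu> n"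
  proof (rule mult_right_mono[OF _ moment_o_nonneg])
    have x: "real n + 2 * \<mu> \<ge> 0" using assms \<mu> by linarith
    have "2 * (real n + 2 * \<mu>) + (3 - 2 * \<mu>) \<le> (3 + 2 * \<bar>\<mu>\<bar>) * (real n + 2 * \<mu>) + (3 + 2 * \<bar>\<mu>\<bar>)"
      by (intro add_mono mult_right_mono x) auto
    also have "\<dots> \<le> 2 * ((3 + 2 * \<bar>\<mu>\<bar>) * (real n + 2 * \<mu>) + (3 + 2 * \<bar>\<mu>\<bar>))"
      using x by simp
    finally show "2 * (real n + 2 * \<mu>) + (3 - 2 * \<mu>) \<le> 2 * ((3 + 2 * \<bar>\<mu>\<bar>) * (1 + (real n + 2 * \<mu>)))"
      by (simp add: algebra_simps)
  qed
  finally show ?thesis by simp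
qed

text \<open>The reverse comparison, with \<open>l = n\<close>: the moment at \<open>n + 1\<close> is
  \<open>(n + 1) * (n + 2 * \<mu>)\<close> times that at \<open>n - 1\<close>. For negative
  \<open>\<mu>\<close> the ratio of \<open>n + 2 * \<mu>\<close> to \<open>n\<close> is smallest at
  \<open>n = 1\<close>, whence the constant \<open>min 1 (1 + 2 * \<mu>)\<close>.\<close>

lemma index_mult_moment_e_le:
  "real n * moment_e \<mu> n \<le> (1 + 1 / min 1 (1 + 2 * \<mu>)) * moment_e \<mu> (Suc n)"
proof (cases n)
  case 0
  then show ?thesis using \<mu> by (simp add: moment_e_nonneg)
next
  case (Suc k)
  define c where "c = min 1 (1 + 2 * \<mu>)"
  have c: "0 < c" "c \<le> 1" "c \<le> 1 + 2 * \<mu>" using \<mu> by (auto simp: c_def)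
  have n: "real n > 0" using Suc by simp
  have "real k * c \<le> real k * 1" by (rule mult_left_mono) (use c in auto)
  then have q: "c * real n \<le> real n + 2 * \<mu>" using c Suc by (simp add: algebra_simps)
  have "c * real n * real n * moment_e \<mu> k \<le> (real n + 2 * \<mu>) * (real n + 1) * moment_e \<mu> k"
    using n q c by (intro mult_right_mono mult_mono moment_e_nonneg) auto
  also have "\<dots> = moment_e \<mu> (Suc n)"
    using Suc by (simp add: moment_e_Suc moment_o_Suc algebra_simps)
  finally have k: "real n * real n * moment_e \<mu> k \<le> moment_e \<mu> (Suc n) / c"
    using c by (simp add: field_simps)
  have "2 * moment_e \<mu> n \<le> real n * moment_e \<mu> k + moment_e \<mu> (Suc n) / real n"
    using moment_e_amgm[of "real n" k] n Suc by simp
  then have "real n * (2 * moment_e \<mu> n) \<le> real n * (real n * moment_e \<mu> k + moment_e \<mu> (Suc n) / real n)"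
    using n by (intro mult_left_mono) auto
  also have "\<dots> = real n * real n * moment_e \<mu> k + moment_e \<mu> (Suc n)"
    using n by (simp add: algebra_simps)
  also have "\<dots> \<le> (1 + 1 / c) * moment_e \<mu> (Suc n)"
    using k by (simp add: algebra_simps)
  finally have "2 * (real n * moment_e \<mu> n) \<le> (1 + 1 / c) * moment_e \<mu> (Suc n)"
    by (simp add: mult_ac)
  \<comment> \<open>Non-negativity allows the factor 2 on the left to be dropped.\<close>
  moreover have "real n * moment_e \<mu> n \<ge> 0" by (simp add: moment_e_nonneg)
  ultimately show ?thesis unfolding c_def by linarith
qed

text \<open>With \<open>l = n\<close>, the moment at \<open>n + 1\<close> is
  \<open>(n + 2 * \<mu> + 1) * n\<close> times that at \<open>n - 1\<close>, so it dominates the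
  first term directly; the second needs only
  \<open>(n + 2 * \<mu>) / n \<le> 1 + 2 * \<bar>\<mu>\<bar>\<close>.\<close>

lemma index_mult_moment_o_le:
  assumes "n \<ge> 1"
  shows "(real n + 2 * \<mu>) * moment_o \<mu> n \<le> (2 + 2 * \<bar>\<mu>\<bar>) * moment_o \<mu> (Suc n)"
proof -
  obtain k where Suc: "n = Suc k" using assms by (cases n) auto
  have n: "real n \<ge> 1" and x: "real n + 2 * \<mu> > 0" using assms \<mu> by linarith+
  have eq: "moment_o \<mu> (Suc n) = (real n + 2 * \<mu> + 1) * real n * moment_o \<mu> k"
    using Suc by (simp add: moment_e_Suc moment_o_Suc algebra_simps)
  have "(real n + 2 * \<mu>) * (2 * moment_o \<mu> n)
      \<le> (real n + 2 * \<mu>) * (real n * moment_o \<mu> k + moment_o \<mu> (Suc n) / real n)"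
    using moment_o_amgm[of "real n" k] n x Suc by (intro mult_left_mono) auto
  also have "\<dots> = (real n + 2 * \<mu>) * real n * moment_o \<mu> k + (real n + 2 * \<mu>) / real n * moment_o \<mu> (Suc n)"
    by (simp add: distrib_left)
  also have "\<dots> \<le> moment_o \<mu> (Suc n) + (1 + 2 * \<bar>\<mu>\<bar>) * moment_o \<mu> (Suc n)"
  proof (intro add_mono mult_right_mono moment_o_nonneg)
    show "(real n + 2 * \<mu>) * real n * moment_o \<mu> k \<le> moment_o \<mu> (Suc n)"
      unfolding eq by (intro mult_right_mono moment_o_nonneg) auto
    have "2 * \<mu> \<le> 2 * \<bar>\<mu>\<bar> * real n"
      using mult_left_mono[OF n, of "2 * \<bar>\<mu>\<bar>"] by simp
    then show "(real n + 2 * \<mu>) / real n \<le> 1 + 2 * \<bar>\<mu>\<bar>" using n by (simp add: field_simps)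
  qed
  finally have "2 * ((real n + 2 * \<mu>) * moment_o \<mu> n) \<le> (2 + 2 * \<bar>\<mu>\<bar>) * moment_o \<mu> (Suc n)"
    by (simp add: algebra_simps)
  moreover have "(real n + 2 * \<mu>) * moment_o \<mu> n \<ge> 0" using x by (simp add: moment_o_nonneg)
  ultimately show ?thesis by linarith
qed

end

subsection \<open>Taylor coefficients and the comparison of energies\<close>

definition taylor_coeff :: "(complex \<Rightarrow> complex) \<Rightarrow> nat \<Rightarrow> complex" where
  "taylor_coeff f n = (deriv ^^ n) f 0 / fact n"

lemma entire_sums_taylor:
  assumes "f holomorphic_on UNIV"
  shows "(\<lambda>n. taylor_coeff f n * z ^ n) sums f z"
  using holomorphic_power_series[of f 0 "cmod z + 1" z] holomorphic_on_subset[OF assms]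
  by (simp add: taylor_coeff_def)

lemma even_part_sums:
  assumes "\<And>z. (\<lambda>n. a n * z ^ n) sums f z"
  shows "(\<lambda>n. (if even n then a n else 0) * z ^ n) sums even_part f z"
proof -
  have "(\<lambda>n. (a n * z ^ n + a n * (- z) ^ n) / 2) sums even_part f z"
    unfolding even_part_def by (intro sums_divide sums_add assms)
  also have "(\<lambda>n. (a n * z ^ n + a n * (- z) ^ n) / 2) = (\<lambda>n. (if even n then a n else 0) * z ^ n)"
    by (auto simp: fun_eq_iff)
  finally show ?thesis .
qed

lemma odd_part_sums:
  assumes "\<And>z. (\<lambda>n. a n * z ^ n) sums f z"
  shows "(\<lambda>n. (if odd n then a n else 0) * z ^ n) sums odd_part f z"
proof -
  have "(\<lambda>n. (a n * z ^ n - a n * (- z) ^ n) / 2) sums odd_part f z"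
    unfolding odd_part_def by (intro sums_divide sums_diff assms)
  also have "(\<lambda>n. (a n * z ^ n - a n * (- z) ^ n) / 2) = (\<lambda>n. (if odd n then a n else 0) * z ^ n)"
    by (auto simp: fun_eq_iff)
  finally show ?thesis .
qed

text \<open>Away from 0 the reflection term is \<open>2 * \<mu> / z\<close> times the odd part.
  Hence a monomial of degree \<open>n + 1\<close> gets the extra factor \<open>2 * \<mu>\<close>
  only if \<open>n\<close> is even.\<close>

lemma dunkl_D_sums:
  assumes f: "f holomorphic_on UNIV"
  shows "(\<lambda>n. of_real (real n + 1 + (if even n then 2 * \<mu> else 0)) * taylor_coeff f (Suc n) * z ^ n)
    sums dunkl_D \<mu> f z"
proof -
  let ?a = "taylor_coeff f"
  have d: "(\<lambda>n. diffs ?a n * z ^ n) sums deriv f z"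
    by (rule termdiffs_sums_strong[where K = "cmod z + 1", OF entire_sums_taylor[OF f]])
      (use f in \<open>auto intro: holomorphic_derivI\<close>)
  show ?thesis
  proof (cases "z = 0")
    case True
    have "deriv f 0 = ?a (Suc 0)" by (simp add: taylor_coeff_def)
    then show ?thesis
      using powser_sums_zero[of "\<lambda>n. of_real (real n + 1 + (if even n then 2 * \<mu> else 0)) * ?a (Suc n)"]
      by (simp add: True dunkl_D_zero[OF f])
  next
    case False
    have "(\<lambda>n. (if odd n then ?a n else 0) * z ^ n) sums odd_part f z"
      by (rule odd_part_sums[OF entire_sums_taylor[OF f]])
    \<comment> \<open>The odd part has no constant term, so shifting the index leaves the sum
      unchanged and makes room for the division by \<open>z\<close>.\<close>
    then have "(\<lambda>n. (if odd (Suc n) then ?a (Suc n) else 0) * z ^ Suc n) sums odd_part f z"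
      by (subst sums_Suc_iff) simp
    then have "(\<lambda>n. 2 * of_real \<mu> / z * ((if odd (Suc n) then ?a (Suc n) else 0) * z ^ Suc n))
        sums (2 * of_real \<mu> / z * odd_part f z)"
      by (rule sums_mult)
    note sums_add[OF d this]
    also have "(\<lambda>n. diffs ?a n * z ^ n + 2 * of_real \<mu> / z * ((if odd (Suc n) then ?a (Suc n) else 0) * z ^ Suc n))
        = (\<lambda>n. of_real (real n + 1 + (if even n then 2 * \<mu> else 0)) * ?a (Suc n) * z ^ n)"
      using False by (auto simp: fun_eq_iff diffs_def algebra_simps)
    also have "deriv f z + 2 * of_real \<mu> / z * odd_part f z = dunkl_D \<mu> f z"
      using False by (simp add: dunkl_D_nonzero[OF f] odd_part_def)
    finally show ?thesis .
  qed
qed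

lemma holomorphic_imp_borel_measurable:
  assumes "f holomorphic_on UNIV"
  shows "f \<in> borel_measurable borel"
  by (intro borel_measurable_continuous_onI holomorphic_on_imp_continuous_on assms)

lemma parts_measurable:
  assumes [measurable]: "f \<in> borel_measurable borel"
  shows "even_part f \<in> borel_measurable borel" "odd_part f \<in> borel_measurable borel"
  unfolding even_part_def[abs_def] odd_part_def[abs_def] by measurable

lemma dens_measurable [measurable]:
  "dens_e \<mu> \<in> borel_measurable borel" "dens_o \<mu> \<in> borel_measurable borel"
  unfolding dens_e_def[abs_def] dens_o_def[abs_def] by measurable

lemma suminf_Suc_ennreal:
  fixes F :: "nat \<Rightarrow> ennreal"
  assumes "F 0 = 0"
  shows "(\<Sum>n. F (Suc n)) = suminf F"
  using suminf_offset[of F 1] assms by simp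

lemma suminf_split_parity:
  fixes m m' :: "nat \<Rightarrow> ennreal" and a :: "nat \<Rightarrow> complex"
  shows "(\<Sum>n. ennreal ((cmod (if even n then a n else 0))\<^sup>2) * m n)
      + (\<Sum>n. ennreal ((cmod (if odd n then a n else 0))\<^sup>2) * m' n)
    = (\<Sum>n. ennreal ((cmod (a n))\<^sup>2) * (if even n then m n else m' n))"
  by (subst suminf_add) (auto intro!: suminf_cong)

section \<open>Norm and energies as weighted series of Taylor coefficients\<close>

context
  fixes \<mu> :: real
  assumes \<mu>: "\<mu> > - 1/2"
begin

lemma nn_integral_nu_e_power_series:
  assumes f: "f \<in> borel_measurable borel" "\<And>z. (\<lambda>n. a n * z ^ n) sums f z"
  shows "(\<integral>\<^sup>+z. ennreal (cmod z ^ (2 * k) * (cmod (f z))\<^sup>2) \<partial>nu_e \<mu>)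
    = (\<Sum>n. ennreal ((cmod (a n))\<^sup>2) * ennreal (moment_e \<mu> (n + k)))"
proof -
  have [measurable]: "f \<in> borel_measurable borel" by fact
  have "(\<integral>\<^sup>+z. ennreal (cmod z ^ (2 * k) * (cmod (f z))\<^sup>2) \<partial>nu_e \<mu>)
      = (\<integral>\<^sup>+z. ennreal (dens_e \<mu> z) * ennreal (cmod z ^ (2 * k) * (cmod (f z))\<^sup>2) \<partial>lborel)"
    unfolding nu_e_def by (rule nn_integral_density) measurable
  also have "\<dots> = (\<Sum>n. ennreal ((cmod (a n))\<^sup>2) * ennreal (moment_e \<mu> (n + k)))"
    unfolding dens_e_def moment_e_def moment_const_def
    by (rule nn_integral_macdonald_weight[OF f]) (use \<mu> Gamma_real_pos[of "\<mu> + 1/2"] in auto)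
  finally show ?thesis .
qed

lemma nn_integral_nu_o_power_series:
  assumes f: "f \<in> borel_measurable borel" "\<And>z. (\<lambda>n. a n * z ^ n) sums f z"
  shows "(\<integral>\<^sup>+z. ennreal (cmod z ^ (2 * k) * (cmod (f z))\<^sup>2) \<partial>nu_o \<mu>)
    = (\<Sum>n. ennreal ((cmod (a n))\<^sup>2) * ennreal (moment_o \<mu> (n + k)))"
proof -
  have [measurable]: "f \<in> borel_measurable borel" by fact
  have "(\<integral>\<^sup>+z. ennreal (cmod z ^ (2 * k) * (cmod (f z))\<^sup>2) \<partial>nu_o \<mu>)
      = (\<integral>\<^sup>+z. ennreal (dens_o \<mu> z) * ennreal (cmod z ^ (2 * k) * (cmod (f z))\<^sup>2) \<partial>lborel)"
    unfolding nu_o_def by (rule nn_integral_density) measurable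
  also have "\<dots> = (\<Sum>n. ennreal ((cmod (a n))\<^sup>2) * ennreal (moment_o \<mu> (n + k)))"
    unfolding dens_o_def moment_o_def moment_const_def
    by (rule nn_integral_macdonald_weight[OF f]) (use \<mu> Gamma_real_pos[of "\<mu> + 1/2"] in auto)
  finally show ?thesis .
qed

lemma B2_norm_sq_power_series:
  assumes f: "f \<in> borel_measurable borel" "\<And>z. (\<lambda>n. a n * z ^ n) sums f z"
  shows "B2_norm_sq \<mu> f
    = (\<Sum>n. ennreal ((cmod (a n))\<^sup>2) * (if even n then ennreal (moment_e \<mu> n) else ennreal (moment_o \<mu> n)))"
  unfolding B2_norm_sq_def L2_norm_sq_def suminf_split_parity[symmetric]
  using nn_integral_nu_e_power_series[OF parts_measurable(1)[OF f(1)] even_part_sums[OF f(2)], of 0]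
    nn_integral_nu_o_power_series[OF parts_measurable(2)[OF f(1)] odd_part_sums[OF f(2)], of 0]
  by simp

lemma energy_power_series:
  assumes f: "f \<in> borel_measurable borel" "\<And>z. (\<lambda>n. a n * z ^ n) sums f z"
  shows "energy \<mu> f = (\<Sum>n. ennreal ((cmod (a n))\<^sup>2)
      * (if even n then ennreal (moment_e \<mu> (Suc n)) else ennreal (moment_o \<mu> (Suc n))))"
  unfolding energy_def energy_e_def energy_o_def suminf_split_parity[symmetric]
  using nn_integral_nu_e_power_series[OF parts_measurable(1)[OF f(1)] even_part_sums[OF f(2)], of 1]
    nn_integral_nu_o_power_series[OF parts_measurable(2)[OF f(1)] odd_part_sums[OF f(2)], of 1]
  by simp

lemma B2_iff_norm_finite:
  assumes "f holomorphic_on UNIV"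
  shows "f \<in> B2 \<mu> \<longleftrightarrow> B2_norm_sq \<mu> f < \<infinity>"
  using assms parts_measurable[OF holomorphic_imp_borel_measurable[OF assms]]
  by (simp add: B2_def L2_space_def B2_norm_sq_def nu_e_def nu_o_def ennreal_add_eq_top less_top)

lemma dirichlet_energy_finite_iff:
  assumes "f holomorphic_on UNIV"
  shows "dirichlet_energy \<mu> f < \<infinity> \<longleftrightarrow> B2_norm_sq \<mu> (dunkl_D \<mu> f) < \<infinity>"
  using B2_iff_norm_finite[OF dunkl_D_entire[OF assms]] by (simp add: dirichlet_energy_def)

text \<open>The operator multiplies a coefficient by \<open>r\<close> and lowers its degree by one.
  Of the resulting \<open>r\<^sup>2\<close>, one factor turns the moment at \<open>n\<close> into
  the moment of opposite parity at \<open>n + 1\<close>, so only a single factor survives.\<close>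

lemma B2_norm_sq_dunkl_D:
  assumes f: "f holomorphic_on UNIV"
  shows "B2_norm_sq \<mu> (dunkl_D \<mu> f) = (\<Sum>n. ennreal ((cmod (taylor_coeff f n))\<^sup>2)
      * ennreal (if even n then real n * moment_e \<mu> n else (real n + 2 * \<mu>) * moment_o \<mu> n))"
    (is "_ = suminf ?F")
proof -
  let ?b = "\<lambda>n. of_real (real n + 1 + (if even n then 2 * \<mu> else 0)) * taylor_coeff f (Suc n)"
  have "B2_norm_sq \<mu> (dunkl_D \<mu> f)
      = (\<Sum>n. ennreal ((cmod (?b n))\<^sup>2) * (if even n then ennreal (moment_e \<mu> n) else ennreal (moment_o \<mu> n)))"
    by (rule B2_norm_sq_power_series[OF holomorphic_imp_borel_measurable[OF dunkl_D_entire[OF f]] dunkl_D_sums[OF f]])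
  also have "\<dots> = (\<Sum>n. ?F (Suc n))"
  proof (rule suminf_cong)
    fix n
    define r where "r = real n + 1 + (if even n then 2 * \<mu> else 0)"
    have b: "(cmod (of_real r * taylor_coeff f (Suc n)))\<^sup>2 = (cmod (taylor_coeff f (Suc n)))\<^sup>2 * r\<^sup>2"
      by (simp add: norm_mult power_mult_distrib power2_eq_square)
    have "(if even (Suc n) then real (Suc n) * moment_e \<mu> (Suc n) else (real (Suc n) + 2 * \<mu>) * moment_o \<mu> (Suc n))
        = r\<^sup>2 * (if even n then moment_e \<mu> n else moment_o \<mu> n)"
      by (simp add: r_def moment_e_Suc[OF \<mu>] moment_o_Suc[OF \<mu>] power2_eq_square algebra_simps)
    then show "ennreal ((cmod (?b n))\<^sup>2) * (if even n then ennreal (moment_e \<mu> n) else ennreal (moment_o \<mu> n)) = ?F (Suc n)"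
      unfolding r_def[symmetric] b
      by (simp add: moment_e_nonneg[OF \<mu>] moment_o_nonneg[OF \<mu>] ennreal_mult mult.assoc)
  qed
  \<comment> \<open>The missing term at degree 0 carries the coefficient
    \<open>real 0\<close>.\<close>
  also have "\<dots> = suminf ?F"
    by (rule suminf_Suc_ennreal) simp
  finally show ?thesis .
qed

end

text \<open>The sequences \<open>m\<close>, \<open>d\<close>, \<open>e\<close> stand for the
  coefficients of norm, Dirichlet energy and deformed energy. Both directions are termwise
  comparison; the second also spends the finiteness of the norm.\<close>

lemma suminf_finite_iff_comparable:
  fixes x :: "nat \<Rightarrow> ennreal" and m d e :: "nat \<Rightarrow> real"
  assumes nn: "\<And>n. 0 \<le> m n" "\<And>n. 0 \<le> d n" "\<And>n. 0 \<le> e n" "0 \<le> C"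
    and de: "\<And>n. d n \<le> C * e n" and ed: "\<And>n. e n \<le> C * (m n + d n)"
    and fin: "(\<Sum>n. x n * ennreal (m n)) < \<infinity>"
  shows "(\<Sum>n. x n * ennreal (e n)) < \<infinity> \<longleftrightarrow> (\<Sum>n. x n * ennreal (d n)) < \<infinity>"
proof
  assume e: "(\<Sum>n. x n * ennreal (e n)) < \<infinity>"
  have "x n * ennreal (d n) \<le> ennreal C * (x n * ennreal (e n))" for n
    using mult_left_mono[OF ennreal_leI[OF de], of "x n" n] nn by (simp add: ennreal_mult mult_ac)
  then have "(\<Sum>n. x n * ennreal (d n)) \<le> (\<Sum>n. ennreal C * (x n * ennreal (e n)))"
    by (intro suminf_le) auto
  also have "\<dots> < \<infinity>" using e by (simp add: ennreal_mult_less_top)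
  finally show "(\<Sum>n. x n * ennreal (d n)) < \<infinity>" .
next
  assume d: "(\<Sum>n. x n * ennreal (d n)) < \<infinity>"
  have "x n * ennreal (e n) \<le> ennreal C * (x n * ennreal (m n) + x n * ennreal (d n))" for n
    using mult_left_mono[OF ennreal_leI[OF ed], of "x n" n] nn
    by (simp add: ennreal_mult ennreal_plus distrib_left mult_ac)
  then have "(\<Sum>n. x n * ennreal (e n)) \<le> (\<Sum>n. ennreal C * (x n * ennreal (m n) + x n * ennreal (d n)))"
    by (intro suminf_le) auto
  also have "\<dots> = ennreal C * ((\<Sum>n. x n * ennreal (m n)) + (\<Sum>n. x n * ennreal (d n)))"
    by (simp add: suminf_add)
  also have "\<dots> < \<infinity>" using d fin by (simp add: ennreal_mult_less_top)
  finally show "(\<Sum>n. x n * ennreal (e n)) < \<infinity>" .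
qed

lemma energy_finite_iff:
  assumes \<mu>: "\<mu> > - 1/2" and f: "f \<in> B2 \<mu>"
  shows "energy \<mu> f < \<infinity> \<longleftrightarrow> dirichlet_energy \<mu> f < \<infinity>"
proof -
  have hol: "f holomorphic_on UNIV" using f by (simp add: B2_def)
  have meas: "f \<in> borel_measurable borel" by (rule holomorphic_imp_borel_measurable[OF hol])
  let ?x = "\<lambda>n. ennreal ((cmod (taylor_coeff f n))\<^sup>2)"
  let ?m = "\<lambda>n. if even n then moment_e \<mu> n else moment_o \<mu> n"
  let ?d = "\<lambda>n. if even n then real n * moment_e \<mu> n else (real n + 2 * \<mu>) * moment_o \<mu> n"
  let ?e = "\<lambda>n. if even n then moment_e \<mu> (Suc n) else moment_o \<mu> (Suc n)"
  \<comment> \<open>One constant above those of all four moment estimates, so that both parities and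
    both directions share it.\<close>
  let ?C = "3 + 2 * \<bar>\<mu>\<bar> + 1 / min 1 (1 + 2 * \<mu>)"
  note nonneg = moment_e_nonneg[OF \<mu>] moment_o_nonneg[OF \<mu>]
  have c: "1 / min 1 (1 + 2 * \<mu>) \<ge> 0" using \<mu> by simp
  \<comment> \<open>An odd index is at least 1, so \<open>\<mu> > - 1/2\<close> keeps
    \<open>n + 2 * \<mu>\<close> non-negative.\<close>
  have odd_nn: "real n + 2 * \<mu> \<ge> 0" "n \<ge> 1" if "odd n" for n
    using that \<mu> odd_pos[of n] by linarith+
  have "(\<Sum>n. ?x n * ennreal (?e n)) < \<infinity> \<longleftrightarrow> (\<Sum>n. ?x n * ennreal (?d n)) < \<infinity>"
  proof (rule suminf_finite_iff_comparable)
    show "0 \<le> ?m n" "0 \<le> ?d n" "0 \<le> ?e n" for n using nonneg odd_nn by auto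
    show "0 \<le> ?C" using c by linarith
    show "?d n \<le> ?C * ?e n" for n
    proof (cases "even n")
      case True
      have "real n * moment_e \<mu> n \<le> (1 + 1 / min 1 (1 + 2 * \<mu>)) * moment_e \<mu> (Suc n)"
        by (rule index_mult_moment_e_le[OF \<mu>])
      also have "\<dots> \<le> ?C * moment_e \<mu> (Suc n)" by (intro mult_right_mono nonneg) simp
      finally show ?thesis using True by simp
    next
      case False
      have "(real n + 2 * \<mu>) * moment_o \<mu> n \<le> (2 + 2 * \<bar>\<mu>\<bar>) * moment_o \<mu> (Suc n)"
        using index_mult_moment_o_le[OF \<mu>] odd_nn False by simp
      also have "\<dots> \<le> ?C * moment_o \<mu> (Suc n)" by (intro mult_right_mono nonneg) (use c in linarith)
      finally show ?thesis using False by simp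
    qed
    show "?e n \<le> ?C * (?m n + ?d n)" for n
    proof (cases "even n")
      case True
      have "moment_e \<mu> (Suc n) \<le> (2 + 2 * \<bar>\<mu>\<bar>) * ((1 + real n) * moment_e \<mu> n)"
        using moment_e_Suc_le[OF \<mu>] by (simp add: mult.assoc)
      also have "\<dots> \<le> ?C * ((1 + real n) * moment_e \<mu> n)"
        by (intro mult_right_mono mult_nonneg_nonneg nonneg) (use c in linarith)+
      \<comment> \<open>Here \<open>(1 + n) * moment_e \<mu> n\<close> is exactly
        \<open>?m n + ?d n\<close>.\<close>
      finally show ?thesis using True by (simp add: distrib_right)
    next
      case False
      have "moment_o \<mu> (Suc n) \<le> (3 + 2 * \<bar>\<mu>\<bar>) * ((1 + (real n + 2 * \<mu>)) * moment_o \<mu> n)"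
        using moment_o_Suc_le[OF \<mu>] odd_nn False by (simp add: mult.assoc)
      also have "\<dots> \<le> ?C * ((1 + (real n + 2 * \<mu>)) * moment_o \<mu> n)"
        using odd_nn(1)[of n] False by (intro mult_right_mono mult_nonneg_nonneg nonneg) (use c in linarith)+
      finally show ?thesis using False by (simp add: distrib_right)
    qed
    have "B2_norm_sq \<mu> f = (\<Sum>n. ?x n * ennreal (?m n))"
      using B2_norm_sq_power_series[OF \<mu> meas entire_sums_taylor[OF hol]] by (simp only: if_distrib)
    then show "(\<Sum>n. ?x n * ennreal (?m n)) < \<infinity>"
      using B2_iff_norm_finite[OF \<mu> hol] f by simp
  qed
  moreover have "energy \<mu> f = (\<Sum>n. ?x n * ennreal (?e n))"
    using energy_power_series[OF \<mu> meas entire_sums_taylor[OF hol]] by (simp only: if_distrib)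
  ultimately show ?thesis
    by (simp only: dirichlet_energy_finite_iff[OF \<mu> hol] B2_norm_sq_dunkl_D[OF \<mu> hol])
qed

lemma energy_even:
  assumes "\<forall>z. g (- z) = g z"
  shows "energy \<mu> g = energy_e \<mu> g"
proof -
  have "even_part g = g" "odd_part g = (\<lambda>_. 0)"
    using assms by (simp_all add: fun_eq_iff even_part_def odd_part_def)
  then show ?thesis by (simp add: energy_def energy_o_def)
qed

lemma energy_odd:
  assumes "\<forall>z. h (- z) = - h z"
  shows "energy \<mu> h = energy_o \<mu> h"
proof -
  have "even_part h = (\<lambda>_. 0)" "odd_part h = h"
    using assms by (simp_all add: fun_eq_iff even_part_def odd_part_def)
  then show ?thesis by (simp add: energy_def energy_e_def)
qed

theorem corollary5p1:
  fixes \<mu> :: real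
  assumes "\<mu> > - 1/2"
  shows "(\<forall>g \<in> B2_even \<mu>. energy_e \<mu> g < \<infinity> \<longleftrightarrow> dirichlet_energy \<mu> g < \<infinity>) \<and>
         (\<forall>h \<in> B2_odd \<mu>. energy_o \<mu> h < \<infinity> \<longleftrightarrow> dirichlet_energy \<mu> h < \<infinity>) \<and>
         (\<forall>f \<in> B2 \<mu>. energy \<mu> f < \<infinity> \<longleftrightarrow> dirichlet_energy \<mu> f < \<infinity>)"
  \<comment> \<open>On even or odd functions one summand of \<open>energy\<close> vanishes, so the
    first two claims are instances of the third.\<close>
  using energy_finite_iff[OF assms]
  by (auto simp: B2_even_def B2_odd_def energy_even[symmetric] energy_odd[symmetric])

end
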